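(* Let $G$ be a graph with $n = |V(G)| \geq 64$ and $\Delta_E \leq d$. For any $\epsilon > 0$, there is a randomized algorithm which, given $V(G)$, $\epsilon$, and access to the Tripartite Independent Set (TIS) oracle of $G$, makes $\mathcal{O}\left( \frac{d^{2}\log^{18} n}{\epsilon^{4}} \right)$ TIS queries and, with probability at least $1-\frac{\mathcal{O}(1)}{n^{2}}$, outputs a number $\hat{t}$ with $|\hat{t} - t(G)| \leq \epsilon \cdot t(G)$.
   Context: For a graph $G$, $t(G)$ denotes the number of triangles of $G$. For an edge $(u,v)$, $\Delta_{(u,v)}$ is the number of triangles of $G$ containing the edge $(u,v)$, and $\Delta_E = \max_{(u,v)\in E(G)} \Delta_{(u,v)}$. For pairwise disjoint non-empty $A,B,C \subseteq V(G)$, $t(A,B,C)$ denotes the number of triangles of $G$ having exactly one vertex in each of $A$, $B$, $C$ (equivalently, the number of triangles of the tripartite subgraph $G(A,B,C)$, i.e., the subgraph induced on $A\cup B\cup C$ with all edges inside $A$, inside $B$, or inside $C$ removed). The TIS oracle takes three pairwise disjoint non-empty sets $V_1,V_2,V_3 \subseteq V(G)$ and answers YES if and only if $t(V_1,V_2,V_3) \neq 0$. The algorithm knows $V(G)$ but learns about edges only through TIS queries. *)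

theory Defs
  imports "HOL-Probability.Probability" "Graph_Theory.Pair_Digraph"
begin

text \<open>
  A finite simple undirected graph is a \<open>pair_graph\<close>: an undirected edge is represented by
  its two orientations in \<open>parcs\<close>.
\<close>

definition triangles :: "'v pair_pre_digraph \<Rightarrow> 'v set set" where
  "triangles G = {T. T \<subseteq> pverts G \<and> card T = 3 \<and>
     (\<forall>u\<in>T. \<forall>v\<in>T. u \<noteq> v \<longrightarrow> (u, v) \<in> parcs G)}"

definition num_triangles :: "'v pair_pre_digraph \<Rightarrow> nat" where
  "num_triangles G = card (triangles G)"

definition edge_triangles :: "'v pair_pre_digraph \<Rightarrow> 'v \<times> 'v \<Rightarrow> nat" where
  "edge_triangles G e = card {T \<in> triangles G. fst e \<in> T \<and> snd e \<in> T}"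

text \<open>The inserted \<open>0\<close> only matters for edgeless graphs, whose maximum is taken to be \<open>0\<close>.\<close>

definition max_edge_triangles :: "'v pair_pre_digraph \<Rightarrow> nat" where
  "max_edge_triangles G = Max (insert 0 (edge_triangles G ` parcs G))"

definition tripartite_triangles ::
  "'v pair_pre_digraph \<Rightarrow> 'v set \<Rightarrow> 'v set \<Rightarrow> 'v set \<Rightarrow> nat" where
  "tripartite_triangles G A B C =
     card {T \<in> triangles G. card (T \<inter> A) = 1 \<and> card (T \<inter> B) = 1 \<and> card (T \<inter> C) = 1}"

definition tis_oracle :: "'v pair_pre_digraph \<Rightarrow> 'v set \<Rightarrow> 'v set \<Rightarrow> 'v set \<Rightarrow> bool" where
  "tis_oracle G A B C \<longleftrightarrow> tripartite_triangles G A B C \<noteq> 0"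

text \<open>
  Randomized query algorithms as decision trees: \<open>Query\<close> branches on the oracle's answer, and
  \<open>Sample\<close> on internal randomness drawn from a discrete distribution. The tree itself does not
  depend on the graph, and only oracle queries are charged. Every run terminates, since a
  datatype has no infinite branches.
\<close>

datatype 'v tis_alg =
    Output real
  | Query "'v set" "'v set" "'v set" "bool \<Rightarrow> 'v tis_alg"
  | Sample "nat pmf" "nat \<Rightarrow> 'v tis_alg"

text \<open>
  The oracle only accepts pairwise disjoint non-empty vertex sets, so this is demanded of every
  query in the tree.
\<close>

primrec legal_alg :: "'v set \<Rightarrow> 'v tis_alg \<Rightarrow> bool" where
  "legal_alg V (Output x) \<longleftrightarrow> True"
| "legal_alg V (Query A B C k) \<longleftrightarrow>
     A \<subseteq> V \<and> B \<subseteq> V \<and> C \<subseteq> V \<and> A \<noteq> {} \<and> B \<noteq> {} \<and> C \<noteq> {} \<and>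
     A \<inter> B = {} \<and> A \<inter> C = {} \<and> B \<inter> C = {} \<and> (\<forall>b. legal_alg V (k b))"
| "legal_alg V (Sample p k) \<longleftrightarrow> (\<forall>i\<in>set_pmf p. legal_alg V (k i))"

text \<open>Joint distribution of the output and the number of queries made.\<close>

primrec run_alg ::
  "('v set \<Rightarrow> 'v set \<Rightarrow> 'v set \<Rightarrow> bool) \<Rightarrow> 'v tis_alg \<Rightarrow> (real \<times> nat) pmf" where
  "run_alg orc (Output x) = return_pmf (x, 0)"
| "run_alg orc (Query A B C k) = map_pmf (\<lambda>(x, q). (x, Suc q)) (run_alg orc (k (orc A B C)))"
| "run_alg orc (Sample p k) = bind_pmf p (\<lambda>i. run_alg orc (k i))"

end

theory Submission
  imports Defs
begin

text \<open>
  Label the vertices by bit strings of length \<open>l\<close>, about \<open>log n\<close>, and let a cell be a triple of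
  label prefixes of equal length; it counts the ordered triangles whose vertices carry these
  prefixes. The root cell counts \<open>6 t(G)\<close>, every cell is the disjoint union of eight subcells, and
  on full labels the count is \<open>0\<close> or \<open>1\<close> and is read off by one query. The estimator is a particle
  filter on this tree: it keeps \<open>N\<close> weighted cells, splits them, and draws \<open>N\<close> of the children with
  probability proportional to weight times a coarse estimate \<open>c\<close> of their count. This is unbiased
  whatever \<open>c\<close> is, and if \<open>E c \<le> \<gamma> T\<close> and \<open>E (1 / c) \<le> \<beta> / T\<close> for cells with count \<open>T\<close>, the second
  moment grows only by the factor \<open>1 + \<beta> \<gamma> / N\<close> per level. A coarse estimate with
  \<open>\<beta> \<gamma> = O(d log^4 n)\<close> comes from testing whether a triangle survives sampling the first two
  coordinates at rates \<open>2 ^ - x\<close> and \<open>2 ^ - y\<close>; the bound \<open>d\<close> on the triangles per edge makes it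
  unnecessary to sample the third one. Chebyshev's inequality and the median of \<open>2 l\<close> runs finish
  the proof.
\<close>

section \<open>Query algorithms as families of distributions\<close>

type_synonym 'v tis = "'v set \<Rightarrow> 'v set \<Rightarrow> 'v set \<Rightarrow> bool"

definition valid_query :: "'v set \<Rightarrow> 'v set \<Rightarrow> 'v set \<Rightarrow> 'v set \<Rightarrow> bool" where
  "valid_query V A B C \<longleftrightarrow> A \<subseteq> V \<and> B \<subseteq> V \<and> C \<subseteq> V \<and> A \<noteq> {} \<and> B \<noteq> {} \<and> C \<noteq> {} \<and>
     A \<inter> B = {} \<and> A \<inter> C = {} \<and> B \<inter> C = {}"

text \<open>
  An algorithm with results of arbitrary type is represented by the map from oracles to its result
  distributions, so that the analysis never mentions decision trees; \<open>q\<close> bounds the number of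
  queries on every run.
\<close>
inductive implementable :: "'v set \<Rightarrow> nat \<Rightarrow> ('v tis \<Rightarrow> 'a pmf) \<Rightarrow> bool" for V :: "'v set" where
  return: "implementable V q (\<lambda>_. return_pmf x)"
| query: "valid_query V A B C \<Longrightarrow> (\<And>b. implementable V q (F b)) \<Longrightarrow>
    implementable V (Suc q) (\<lambda>orc. F (orc A B C) orc)"
| sample: "(\<And>i. i \<in> set_pmf p \<Longrightarrow> implementable V q (F i)) \<Longrightarrow>
    implementable V q (\<lambda>orc. bind_pmf (p :: nat pmf) (\<lambda>i. F i orc))"

lemma implementable_cong:
  "implementable V q F \<Longrightarrow> (\<And>orc. F orc = F' orc) \<Longrightarrow> q = q' \<Longrightarrow> implementable V q' F'"
  by (metis ext)

lemma implementable_mono: "implementable V q F \<Longrightarrow> q \<le> q' \<Longrightarrow> implementable V q' F"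
proof (induction arbitrary: q' rule: implementable.induct)
  case (query A B C q F)
  then obtain q'' where "q' = Suc q''" "q \<le> q''"
    by (cases q') auto
  then show ?case
    using implementable.query[OF query(1), of q'' F] query by simp
qed (auto intro: implementable.intros)

text \<open>\<open>sample\<close> draws natural numbers only, but the support of any pmf is
  countable, so values of every type can be encoded through \<open>to_nat_on\<close>.\<close>

lemma implementable_sample:
  fixes p :: "'b pmf"
  assumes "\<And>x. x \<in> set_pmf p \<Longrightarrow> implementable V q (F x)"
  shows "implementable V q (\<lambda>orc. bind_pmf p (\<lambda>x. F x orc))"
proof -
  define p' where "p' = map_pmf (to_nat_on (set_pmf p)) p"
  define g where "g = from_nat_into (set_pmf p)"
  \<comment> \<open>Decoding lands in the support for every index, even one that encodes nothing, so
    \<open>F (g i)\<close> is always implementable.\<close>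
  have g: "g i \<in> set_pmf p" for i
    by (simp add: g_def from_nat_into set_pmf_not_empty)
  have "implementable V q (\<lambda>orc. bind_pmf p' (\<lambda>i. F (g i) orc))"
    using g assms by (intro implementable.sample) auto
  moreover have "bind_pmf p' (\<lambda>i. F (g i) orc) = bind_pmf p (\<lambda>x. F x orc)" for orc
    unfolding p'_def bind_map_pmf by (intro bind_pmf_cong) (auto simp: g_def)
  ultimately show ?thesis
    by simp
qed

lemma implementable_bind:
  assumes "implementable V q1 F" and "\<And>x. implementable V q2 (G x)"
  shows "implementable V (q1 + q2) (\<lambda>orc. bind_pmf (F orc) (\<lambda>x. G x orc))"
  using assms
proof (induction rule: implementable.induct)
  case (return q x)
  then have "implementable V (q + q2) (G x)"
    by (meson implementable_mono le_add2)
  then show ?case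
    by (simp add: bind_return_pmf)
next
  case (query A B C q F)
  then show ?case
    using implementable.query[OF query(1), of "q + q2" "\<lambda>b orc. bind_pmf (F b orc) (\<lambda>x. G x orc)"]
    by simp
next
  case (sample p q F)
  then show ?case
    using implementable.sample[of p V "q + q2" "\<lambda>i orc. bind_pmf (F i orc) (\<lambda>x. G x orc)"]
    by (simp add: bind_assoc_pmf)
qed

lemma implementable_map:
  assumes "implementable V q F"
  shows "implementable V q (\<lambda>orc. map_pmf g (F orc))"
proof -
  have "implementable V (q + 0) (\<lambda>orc. bind_pmf (F orc) (\<lambda>x. return_pmf (g x)))"
    by (intro implementable_bind assms implementable.return)
  then show ?thesis
    by (simp add: map_pmf_def)
qed

text \<open>Independent runs are executed one after another: a product over
  \<open>insert j J\<close> is a draw at \<open>j\<close> followed by a product over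
  \<open>J\<close>, and the budgets add up.\<close>

lemma implementable_Pi_pmf:
  assumes "finite J" and "\<And>j. j \<in> J \<Longrightarrow> implementable V q (F j)"
  shows "implementable V (card J * q) (\<lambda>orc. Pi_pmf J d (\<lambda>j. F j orc))"
  using assms
proof (induction J rule: finite_induct)
  case empty
  then show ?case by (simp add: implementable.return)
next
  case (insert j J)
  have *: "Pi_pmf (insert j J) d (\<lambda>j. F j orc) =
     bind_pmf (F j orc) (\<lambda>y. map_pmf (\<lambda>f. f(j := y)) (Pi_pmf J d (\<lambda>j. F j orc)))" for orc
    using insert by (simp add: Pi_pmf_insert' map_pmf_def)
  have "implementable V (q + card J * q) (\<lambda>orc. bind_pmf (F j orc)
          (\<lambda>y. map_pmf (\<lambda>f. f(j := y)) (Pi_pmf J d (\<lambda>j. F j orc))))"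
    using insert by (intro implementable_bind implementable_map) auto
  then show ?case
    using insert by (simp add: *)
qed

text \<open>Totalises the oracle. Validity depends on the sets alone and not on the graph, so an
  invalid query is answered \<open>False\<close> without being issued and the trees stay
  legal.\<close>

definition guarded :: "'v set \<Rightarrow> 'v tis \<Rightarrow> 'v tis" where
  "guarded V orc A B C \<longleftrightarrow> valid_query V A B C \<and> orc A B C"

lemma implementable_guarded: "implementable V 1 (\<lambda>orc. return_pmf (guarded V orc A B C))"
proof (cases "valid_query V A B C")
  case True
  from implementable.query[OF True, of 0 "\<lambda>b _. return_pmf b"] show ?thesis
    using True by (simp add: implementable.return guarded_def)
next
  case False
  then show ?thesis by (simp add: guarded_def implementable.return)
qed

lemma implementable_Bex_guarded:
  assumes "finite I"
  shows "implementable V (card I)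
           (\<lambda>orc. return_pmf (\<exists>i\<in>I. guarded V orc (f i) (g i) (h i)))"
proof -
  have "implementable V (card I * 1) (\<lambda>orc. map_pmf (\<lambda>y. \<exists>i\<in>I. y i)
          (Pi_pmf I False (\<lambda>i. return_pmf (guarded V orc (f i) (g i) (h i)))))"
    using assms by (intro implementable_map implementable_Pi_pmf implementable_guarded)
  then show ?thesis
    using assms by (simp cong: bex_cong)
qed

text \<open>The way back to decision trees: each introduction rule corresponds to one tree
  constructor. The tree is chosen before the oracle, so a single tree serves all graphs.\<close>

lemma implementable_imp_alg:
  fixes F :: "'v tis \<Rightarrow> real pmf"
  assumes "implementable V q F"
  shows "\<exists>alg. legal_alg V alg \<and>
    (\<forall>orc. map_pmf fst (run_alg orc alg) = F orc \<and> (\<forall>(t, k) \<in> set_pmf (run_alg orc alg). k \<le> q))"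
  using assms
proof (induction rule: implementable.induct)
  case (return q x)
  show ?case by (rule exI[of _ "Output x"]) auto
next
  case (query A B C q F)
  then obtain alg where "\<And>b. legal_alg V (alg b) \<and>
    (\<forall>orc. map_pmf fst (run_alg orc (alg b)) = F b orc \<and>
      (\<forall>(t, k) \<in> set_pmf (run_alg orc (alg b)). k \<le> q))"
    by metis
  with query(1) show ?case
    by (intro exI[of _ "Query A B C alg"])
       (fastforce simp: valid_query_def pmf.map_comp o_def case_prod_unfold)
next
  case (sample p q F)
  \<comment> \<open>Membership in the support is put under the existential so that choice yields a
    total function of subtrees.\<close>
  then have "\<forall>i. \<exists>alg. i \<in> set_pmf p \<longrightarrow> legal_alg V alg \<and>
    (\<forall>orc. map_pmf fst (run_alg orc alg) = F i orc \<and>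
      (\<forall>(t, k) \<in> set_pmf (run_alg orc alg). k \<le> q))"
    by blast
  then obtain alg where "\<And>i. i \<in> set_pmf p \<Longrightarrow> legal_alg V (alg i) \<and>
    (\<forall>orc. map_pmf fst (run_alg orc (alg i)) = F i orc \<and>
      (\<forall>(t, k) \<in> set_pmf (run_alg orc (alg i)). k \<le> q))"
    by metis
  then show ?case
    by (intro exI[of _ "Sample p alg"])
       (fastforce simp: map_bind_pmf intro!: bind_pmf_cong)
qed

section \<open>Moments of the particle filter\<close>

abbreviation "E \<equiv> measure_pmf.expectation"

lemma expectation_bind_finite:
  fixes g :: "'b \<Rightarrow> real"
  assumes "finite (set_pmf p)" "\<And>x. x \<in> set_pmf p \<Longrightarrow> finite (set_pmf (f x))"
  shows "E (bind_pmf p f) g = E p (\<lambda>x. E (f x) g)"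
proof -
  have "E (bind_pmf p f) g = (\<Sum>a\<in>set_pmf p. pmf p a *\<^sub>R E (f a) g)"
    using assms by (intro pmf_expectation_bind) auto
  also have "\<dots> = E p (\<lambda>x. E (f x) g)"
    using assms by (intro integral_measure_pmf[symmetric]) auto
  finally show ?thesis .
qed

lemma finite_set_Pi_pmf:
  "finite A \<Longrightarrow> (\<And>x. x \<in> A \<Longrightarrow> finite (set_pmf (p x))) \<Longrightarrow> finite (set_pmf (Pi_pmf A d p))"
  by (auto simp: set_Pi_pmf intro!: finite_PiE_dflt)

lemma set_Pi_pmf_component:
  "finite A \<Longrightarrow> h \<in> set_pmf (Pi_pmf A d p) \<Longrightarrow> x \<in> A \<Longrightarrow> h x \<in> set_pmf (p x)"
  by (auto simp: set_Pi_pmf PiE_dflt_def)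

lemma expectation_mono_finite:
  fixes f g :: "'a \<Rightarrow> real"
  assumes "finite (set_pmf p)" "\<And>x. x \<in> set_pmf p \<Longrightarrow> f x \<le> g x"
  shows "E p f \<le> E p g"
  using assms by (intro integral_mono_AE integrable_measure_pmf_finite AE_pmfI) auto

lemma expectation_cong:
  fixes f g :: "'a \<Rightarrow> real"
  assumes "\<And>x. x \<in> set_pmf p \<Longrightarrow> f x = g x"
  shows "E p f = E p g"
  using assms by (intro integral_cong_AE AE_pmfI) auto

lemma expectation_Pi_pmf_component:
  fixes f :: "'b \<Rightarrow> real"
  assumes "finite A" "i \<in> A"
  shows "E (Pi_pmf A d p) (\<lambda>y. f (y i)) = E (p i) f"
  using assms integral_map_pmf[of "\<lambda>y. y i" "Pi_pmf A d p" f] by (simp add: Pi_pmf_component)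

lemma expectation_Pi_pmf_pair:
  fixes f g :: "'b \<Rightarrow> real"
  assumes A: "finite A" "i \<in> A" "j \<in> A" "i \<noteq> j"
    and fin: "\<And>x. x \<in> A \<Longrightarrow> finite (set_pmf (p x))"
    and pos: "\<And>y. y \<in> set_pmf (p i) \<Longrightarrow> f y \<ge> 0" "\<And>y. y \<in> set_pmf (p j) \<Longrightarrow> g y \<ge> 0"
  shows "E (Pi_pmf A d p) (\<lambda>y. f (y i) * g (y j)) = E (p i) f * E (p j) g"
proof -
  \<comment> \<open>Padding with the constant 1 at all other indices turns the two factors into a
    product over \<open>A\<close>, to which \<open>expectation_prod_Pi_pmf\<close> applies.\<close>
  define F where "F x = (if x = i then f else if x = j then g else (\<lambda>_. 1))" for x
  define A' where "A' = A - {i, j}"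
  have A': "A = insert i (insert j A')" "i \<notin> A'" "j \<notin> A'" "finite A'"
    using A by (auto simp: A'_def)
  have prod_eq: "(\<Prod>x\<in>A. G x) = G i * G j" if "\<And>x. x \<in> A' \<Longrightarrow> G x = 1" for G :: "'a \<Rightarrow> real"
    using A' A(4) that by (simp add: prod.neutral)
  have F': "F x = (\<lambda>_. 1)" if "x \<in> A'" for x
    using that A' by (auto simp: F_def)
  have "E (Pi_pmf A d p) (\<lambda>y. \<Prod>x\<in>A. F x (y x)) = (\<Prod>x\<in>A. E (p x) (F x))"
    using A fin pos by (intro expectation_prod_Pi_pmf integrable_measure_pmf_finite)
      (auto simp: F_def)
  moreover have "(\<Prod>x\<in>A. F x (y x)) = f (y i) * g (y j)" for y
    using A(4) F' by (subst prod_eq) (auto simp: F_def)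
  moreover have "(\<Prod>x\<in>A. E (p x) (F x)) = E (p i) f * E (p j) g"
    using A(4) F' by (subst prod_eq) (auto simp: F_def)
  ultimately show ?thesis by simp
qed

text \<open>In the expanded square, off-diagonal pairs contribute \<open>(E p f)^2\<close> by
  independence and diagonal ones the second moment of \<open>f\<close>. The bound adds
  \<open>(E p f)^2\<close> on the diagonal as well, which completes the square.\<close>

lemma iid_sum_moments:
  fixes f :: "'b \<Rightarrow> real"
  assumes fin: "finite (set_pmf p)" and pos: "\<And>y. y \<in> set_pmf p \<Longrightarrow> f y \<ge> 0"
  shows "E (Pi_pmf {..<N} d (\<lambda>_. p)) (\<lambda>y. \<Sum>k<N. f (y k)) = real N * E p f"
    and "E (Pi_pmf {..<N} d (\<lambda>_. p)) (\<lambda>y. (\<Sum>k<N. f (y k))\<^sup>2)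
           \<le> real N * E p (\<lambda>y. (f y)\<^sup>2) + (real N * E p f)\<^sup>2"
proof -
  let ?P = "Pi_pmf {..<N} d (\<lambda>_. p)"
  have int: "integrable ?P F" for F :: "_ \<Rightarrow> real"
    using fin by (intro integrable_measure_pmf_finite finite_set_Pi_pmf) auto
  show "E ?P (\<lambda>y. \<Sum>k<N. f (y k)) = real N * E p f"
    by (simp add: Bochner_Integration.integral_sum[OF int] expectation_Pi_pmf_component)
  have "E ?P (\<lambda>y. (\<Sum>k<N. f (y k))\<^sup>2) = (\<Sum>k<N. \<Sum>l<N. E ?P (\<lambda>y. f (y k) * f (y l)))"
    by (simp add: power2_eq_square sum_product Bochner_Integration.integral_sum[OF int])
  also have "\<dots> \<le> (\<Sum>k<N. \<Sum>l<N. (if l = k then E p (\<lambda>y. (f y)\<^sup>2) else 0) + (E p f)\<^sup>2)"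
  proof (intro sum_mono)
    fix k l assume kl: "k \<in> {..<N}" "l \<in> {..<N}"
    show "E ?P (\<lambda>y. f (y k) * f (y l)) \<le> (if l = k then E p (\<lambda>y. (f y)\<^sup>2) else 0) + (E p f)\<^sup>2"
    proof (cases "l = k")
      case True
      then have "E ?P (\<lambda>y. f (y k) * f (y l)) = E p (\<lambda>y. (f y)\<^sup>2)"
        using kl expectation_Pi_pmf_component[of "{..<N}" k d "\<lambda>_. p" "\<lambda>y. (f y)\<^sup>2"]
        by (simp add: power2_eq_square)
      with True show ?thesis by simp
    next
      case False
      then have "E ?P (\<lambda>y. f (y k) * f (y l)) = E p f * E p f"
        using kl fin pos by (intro expectation_Pi_pmf_pair) auto
      with False show ?thesis by (simp add: power2_eq_square)
    qed
  qed
  also have "\<dots> = real N * E p (\<lambda>y. (f y)\<^sup>2) + (real N * E p f)\<^sup>2"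
    by (simp add: sum.distrib sum.delta power2_eq_square algebra_simps)
  finally show "E ?P (\<lambda>y. (\<Sum>k<N. f (y k))\<^sup>2)
           \<le> real N * E p (\<lambda>y. (f y)\<^sup>2) + (real N * E p f)\<^sup>2" .
qed

section \<open>Weighted sampling and resampling\<close>

definition weighted_pmf :: "'i set \<Rightarrow> ('i \<Rightarrow> real) \<Rightarrow> 'i pmf" where
  "weighted_pmf I g = (if (\<forall>i\<in>I. g i \<ge> 0) \<and> sum g I > 0
     then embed_pmf (\<lambda>i. if i \<in> I then g i / sum g I else 0) else return_pmf (SOME i. i \<in> I))"

lemma pmf_weighted_pmf:
  assumes "finite I" "\<And>i. i \<in> I \<Longrightarrow> g i \<ge> 0" "sum g I > 0"
  shows "pmf (weighted_pmf I g) i = (if i \<in> I then g i / sum g I else 0)"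
proof -
  have "(\<integral>\<^sup>+ i. ennreal (if i \<in> I then g i / sum g I else 0) \<partial>count_space UNIV) =
      (\<Sum>i\<in>I. ennreal (if i \<in> I then g i / sum g I else 0))"
    using assms(1) by (intro nn_integral_count_space') auto
  also have "\<dots> = ennreal (\<Sum>i\<in>I. g i / sum g I)"
    using assms by (simp add: sum_ennreal)
  also have "\<dots> = 1"
    using assms by (simp flip: sum_divide_distrib)
  finally show ?thesis
    using assms unfolding weighted_pmf_def by (simp add: pmf_embed_pmf)
qed

text \<open>This is what the fallback point mass of \<open>weighted_pmf\<close> is for: the support
  stays inside \<open>I\<close> even if all weights are zero.\<close>

lemma set_weighted_pmf_subset:
  assumes "finite I" "I \<noteq> {}"
  shows "set_pmf (weighted_pmf I g) \<subseteq> I"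
proof (cases "(\<forall>i\<in>I. g i \<ge> 0) \<and> sum g I > 0")
  case True
  then show ?thesis
    using pmf_weighted_pmf[OF assms(1), of g] by (auto simp: set_pmf_eq)
next
  case False
  then show ?thesis
    using assms by (auto simp: weighted_pmf_def some_in_eq)
qed

lemma expectation_weighted_pmf:
  assumes "finite I" "\<And>i. i \<in> I \<Longrightarrow> g i \<ge> 0" "sum g I > 0"
  shows "E (weighted_pmf I g) f = (\<Sum>i\<in>I. g i / sum g I * f i)"
proof -
  have "I \<noteq> {}" using assms by auto
  then have "E (weighted_pmf I g) f = (\<Sum>i\<in>I. pmf (weighted_pmf I g) i *\<^sub>R f i)"
    using assms set_weighted_pmf_subset[of I g] by (intro integral_measure_pmf) auto
  then show ?thesis using assms by (simp add: pmf_weighted_pmf)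
qed

text \<open>Importance sampling: with \<open>S\<close> the total of \<open>w i * h i\<close>, index
  \<open>i\<close> is drawn with probability \<open>w i * h i / S\<close> and receives the new
  weight \<open>S / (N * h i)\<close>, which cancels the bias of the draw.\<close>

definition resample ::
  "nat \<Rightarrow> 'i set \<Rightarrow> ('i \<Rightarrow> real) \<Rightarrow> ('i \<Rightarrow> real) \<Rightarrow> (nat \<Rightarrow> real \<times> 'i) pmf" where
  "resample N I w h =
     map_pmf (\<lambda>J k. ((\<Sum>i\<in>I. w i * h i) / (real N * h (J k)), J k))
       (Pi_pmf {..<N} undefined (\<lambda>_. weighted_pmf I (\<lambda>i. w i * h i)))"

lemma finite_set_resample: "finite I \<Longrightarrow> I \<noteq> {} \<Longrightarrow> finite (set_pmf (resample N I w h))"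
  unfolding resample_def set_map_pmf
  by (intro finite_imageI finite_set_Pi_pmf)
     (auto intro: finite_subset[OF set_weighted_pmf_subset])

lemma set_resample:
  assumes "finite I" "I \<noteq> {}" "s \<in> set_pmf (resample N I w h)" "k < N"
  shows "snd (s k) \<in> I" and "fst (s k) = (\<Sum>i\<in>I. w i * h i) / (real N * h (snd (s k)))"
proof -
  obtain J where J: "J \<in> set_pmf (Pi_pmf {..<N} undefined (\<lambda>_. weighted_pmf I (\<lambda>i. w i * h i)))"
    and s: "s = (\<lambda>k. ((\<Sum>i\<in>I. w i * h i) / (real N * h (J k)), J k))"
    using assms(3) by (auto simp: resample_def)
  have "J k \<in> I"
    using set_Pi_pmf_component[OF _ J, of k] set_weighted_pmf_subset[OF assms(1,2)] assms(4) by blast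
  then show "snd (s k) \<in> I" and "fst (s k) = (\<Sum>i\<in>I. w i * h i) / (real N * h (snd (s k)))"
    by (simp_all add: s)
qed

text \<open>The mean is preserved for every \<open>h\<close> that vanishes only where
  \<open>t\<close> does; the quality of \<open>h\<close> enters only through the ratios
  \<open>h j / h i\<close> in the second moment.\<close>

lemma resample_moments:
  fixes w h t :: "'i \<Rightarrow> real"
  assumes I: "finite I" "I \<noteq> {}" and N: "N > 0"
    and w: "\<And>i. i \<in> I \<Longrightarrow> w i \<ge> 0" and h: "\<And>i. i \<in> I \<Longrightarrow> h i \<ge> 0"
    and t: "\<And>i. i \<in> I \<Longrightarrow> t i \<ge> 0" and ht: "\<And>i. i \<in> I \<Longrightarrow> h i = 0 \<Longrightarrow> t i = 0"
  shows "E (resample N I w h) (\<lambda>s. \<Sum>k<N. fst (s k) * t (snd (s k))) = (\<Sum>i\<in>I. w i * t i)"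
    and "E (resample N I w h) (\<lambda>s. (\<Sum>k<N. fst (s k) * t (snd (s k)))\<^sup>2) \<le>
           (\<Sum>i\<in>I. w i * t i)\<^sup>2 + (\<Sum>i\<in>I. \<Sum>j\<in>I. w i * w j * (t i)\<^sup>2 * (h j / h i)) / real N"
proof -
  define S where "S = (\<Sum>i\<in>I. w i * h i)"
  define p where "p = weighted_pmf I (\<lambda>i. w i * h i)"
  define f where "f i = S / (real N * h i) * t i" for i
  have S: "S \<ge> 0"
    using w h by (auto simp: S_def intro!: sum_nonneg)
  have p: "set_pmf p \<subseteq> I"
    using I by (simp add: p_def set_weighted_pmf_subset)
  have fin: "finite (set_pmf p)"
    using I p by (auto intro: finite_subset)
  have f: "f i \<ge> 0" if "i \<in> set_pmf p" for i
    using that p S h t by (auto simp: f_def)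
  have eq: "E (resample N I w h) (\<lambda>s. g (\<Sum>k<N. fst (s k) * t (snd (s k)))) =
      E (Pi_pmf {..<N} undefined (\<lambda>_. p)) (\<lambda>J. g (\<Sum>k<N. f (J k)))" for g :: "real \<Rightarrow> real"
    by (simp add: resample_def p_def f_def S_def)
  have Ef: "real N * E p f = (\<Sum>i\<in>I. w i * t i)"
    and Ef2: "real N * E p (\<lambda>y. (f y)\<^sup>2) =
      (\<Sum>i\<in>I. \<Sum>j\<in>I. w i * w j * (t i)\<^sup>2 * (h j / h i)) / real N"
  proof -
    have *: "(\<Sum>i\<in>I. \<Sum>j\<in>I. w i * w j * (t i)\<^sup>2 * (h j / h i)) = (\<Sum>i\<in>I. w i * (t i)\<^sup>2 / h i * S)"
      by (simp add: S_def sum_distrib_left sum_distrib_right sum_divide_distrib mult_ac)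
    have "real N * E p f = (\<Sum>i\<in>I. w i * t i) \<and>
      real N * E p (\<lambda>y. (f y)\<^sup>2) = (\<Sum>i\<in>I. w i * (t i)\<^sup>2 / h i * S) / real N"
    \<comment> \<open>For \<open>S = 0\<close> the draw is the fallback point mass. Then every
      \<open>w i * t i\<close> vanishes, and \<open>f\<close> is 0 because its numerator is, so all
      sides are 0.\<close>
    proof (cases "S = 0")
      case True
      then have "w i * h i = 0" if "i \<in> I" for i
        using that I w h by (simp add: S_def sum_nonneg_eq_0_iff)
      then have "w i * t i = 0" if "i \<in> I" for i
        using that ht by fastforce
      then have "(\<Sum>i\<in>I. w i * t i) = 0"
        by (intro sum.neutral) auto
      moreover have "f = (\<lambda>_. 0)"
        using True by (simp add: f_def fun_eq_iff)
      ultimately show ?thesis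
        using True by simp
    next
      case False
      with S have S': "S > 0" by simp
      have Ep: "E p g = (\<Sum>i\<in>I. w i * h i / S * g i)" for g
        using I w h S' unfolding p_def S_def by (intro expectation_weighted_pmf) auto
      have "real N * (w i * h i / S * f i) = w i * t i" if "i \<in> I" for i
        using that ht[of i] S' N by (cases "h i = 0") (auto simp: f_def)
      moreover have "real N * (w i * h i / S * (f i)\<^sup>2) = w i * (t i)\<^sup>2 / h i * S / real N" if "i \<in> I" for i
        using that ht[of i] S' N by (cases "h i = 0") (auto simp: f_def power2_eq_square field_simps)
      ultimately show ?thesis
        by (simp add: Ep sum_distrib_left sum_divide_distrib)
    qed
    then show "real N * E p f = (\<Sum>i\<in>I. w i * t i)"
      and "real N * E p (\<lambda>y. (f y)\<^sup>2) =
      (\<Sum>i\<in>I. \<Sum>j\<in>I. w i * w j * (t i)\<^sup>2 * (h j / h i)) / real N"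
      unfolding * by blast+
  qed
  show "E (resample N I w h) (\<lambda>s. \<Sum>k<N. fst (s k) * t (snd (s k))) = (\<Sum>i\<in>I. w i * t i)"
    using eq[of "\<lambda>x. x"] iid_sum_moments(1)[of p f N undefined] fin f Ef by simp
  show "E (resample N I w h) (\<lambda>s. (\<Sum>k<N. fst (s k) * t (snd (s k)))\<^sup>2) \<le>
           (\<Sum>i\<in>I. w i * t i)\<^sup>2 + (\<Sum>i\<in>I. \<Sum>j\<in>I. w i * w j * (t i)\<^sup>2 * (h j / h i)) / real N"
    using eq[of "\<lambda>x. x\<^sup>2"] iid_sum_moments(2)[of p f N undefined] fin f Ef Ef2 by simp
qed

text \<open>No concentration is asked for: ratios of independent estimates are controlled by the
  means of \<open>c\<close> and \<open>1 / c\<close> alone. For \<open>t = 0\<close> the bound on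
  the mean forces \<open>c = 0\<close>.\<close>

definition coarse_estimate :: "real \<Rightarrow> real \<Rightarrow> real \<Rightarrow> real pmf \<Rightarrow> bool" where
  "coarse_estimate \<beta> \<gamma> t C \<longleftrightarrow> finite (set_pmf C) \<and>
     (\<forall>c\<in>set_pmf C. c \<ge> 0 \<and> (t > 0 \<longrightarrow> c > 0)) \<and>
     E C (\<lambda>c. c) \<le> \<gamma> * t \<and> (t > 0 \<longrightarrow> E C (\<lambda>c. 1 / c) \<le> \<beta> / t)"

text \<open>For distinct \<open>i\<close> and \<open>j\<close> independence gives
  \<open>E (h j / h i) \<le> \<beta> * \<gamma> * t j / t i\<close>. Multiplied by
  \<open>(t i)^2\<close> this is symmetric in \<open>i\<close> and \<open>j\<close>, and the double
  sum collapses to the square of the weighted total.\<close>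

lemma coarse_resample_moments:
  fixes w t :: "'i \<Rightarrow> real"
  assumes I: "finite I" "I \<noteq> {}" and N: "N > 0"
    and w: "\<And>i. i \<in> I \<Longrightarrow> w i \<ge> 0" and t: "\<And>i. i \<in> I \<Longrightarrow> t i \<ge> 0"
    and C: "\<And>i. i \<in> I \<Longrightarrow> coarse_estimate \<beta> \<gamma> (t i) (C i)"
    and bc: "\<beta> * \<gamma> \<ge> 1" "\<beta> \<ge> 0" "\<gamma> \<ge> 0"
  defines "P \<equiv> bind_pmf (Pi_pmf I 0 C) (resample N I w)"
  shows "E P (\<lambda>s. \<Sum>k<N. fst (s k) * t (snd (s k))) = (\<Sum>i\<in>I. w i * t i)"
    and "E P (\<lambda>s. (\<Sum>k<N. fst (s k) * t (snd (s k)))\<^sup>2) \<le>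
           (1 + \<beta> * \<gamma> / real N) * (\<Sum>i\<in>I. w i * t i)\<^sup>2"
proof -
  let ?H = "Pi_pmf I 0 C"
  let ?W = "\<Sum>i\<in>I. w i * t i"
  have finC: "finite (set_pmf (C i))" if "i \<in> I" for i
    using C[OF that] by (simp add: coarse_estimate_def)
  have finH: "finite (set_pmf ?H)"
    using I finC by (intro finite_set_Pi_pmf)
  have int: "integrable ?H F" for F :: "_ \<Rightarrow> real"
    using finH by (intro integrable_measure_pmf_finite)
  have H: "h i \<ge> 0" "h i = 0 \<Longrightarrow> t i = 0" if "h \<in> set_pmf ?H" "i \<in> I" for h i
  proof -
    have "h i \<in> set_pmf (C i)"
      using set_Pi_pmf_component[OF I(1) that] .
    with C[OF that(2)] t[OF that(2)] show "h i \<ge> 0" "h i = 0 \<Longrightarrow> t i = 0"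
      by (force simp: coarse_estimate_def)+
  qed
  have EP: "E P g = E ?H (\<lambda>h. E (resample N I w h) g)" for g :: "_ \<Rightarrow> real"
    unfolding P_def using finH I by (intro expectation_bind_finite finite_set_resample)
  have "E P (\<lambda>s. \<Sum>k<N. fst (s k) * t (snd (s k))) = E ?H (\<lambda>_. ?W)"
    unfolding EP using I N w t H by (intro expectation_cong resample_moments)
  then show "E P (\<lambda>s. \<Sum>k<N. fst (s k) * t (snd (s k))) = ?W"
    by simp
  have ratio: "(t i)\<^sup>2 * E ?H (\<lambda>h. h j / h i) \<le> \<beta> * \<gamma> * (t i * t j)" if ij: "i \<in> I" "j \<in> I" for i j
  proof -
    consider "t i = 0" | "t i > 0" "i = j" | "t i > 0" "i \<noteq> j"
      using t[OF ij(1)] by fastforce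
    then show ?thesis
    proof cases
      case 1
      then show ?thesis by simp
    next
      case 2
      \<comment> \<open>On the diagonal numerator and denominator are not independent, but their
        ratio is at most 1; here \<open>\<beta> * \<gamma> \<ge> 1\<close> enters.\<close>
      have "E ?H (\<lambda>h. h j / h i) \<le> E ?H (\<lambda>_. 1)"
        using 2 finH by (intro expectation_mono_finite) auto
      also have "\<dots> \<le> \<beta> * \<gamma>"
        using bc by simp
      finally show ?thesis
        using 2 by (simp add: power2_eq_square mult.commute mult_left_mono)
    next
      case 3
      have "E ?H (\<lambda>h. h j / h i) = E ?H (\<lambda>h. 1 / h i * h j)"
        by simp
      also have "\<dots> = E (C i) (\<lambda>c. 1 / c) * E (C j) (\<lambda>c. c)"
        using I ij 3 finC C[OF ij(1)] C[OF ij(2)]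
        by (intro expectation_Pi_pmf_pair[where f = "\<lambda>c. 1 / c" and g = "\<lambda>c. c"])
           (auto simp: coarse_estimate_def)
      also have "\<dots> \<le> (\<beta> / t i) * (\<gamma> * t j)"
      proof (intro mult_mono)
        show "0 \<le> E (C j) (\<lambda>c. c)"
          using C[OF ij(2)] by (intro Bochner_Integration.integral_nonneg_AE AE_pmfI) (auto simp: coarse_estimate_def)
      qed (use C[OF ij(1)] C[OF ij(2)] 3 bc in \<open>auto simp: coarse_estimate_def\<close>)
      finally have "(t i)\<^sup>2 * E ?H (\<lambda>h. h j / h i) \<le> (t i)\<^sup>2 * ((\<beta> / t i) * (\<gamma> * t j))"
        by (intro mult_left_mono) auto
      also have "\<dots> = \<beta> * \<gamma> * (t i * t j)"
        using 3 by (simp add: power2_eq_square)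
      finally show ?thesis .
    qed
  qed
  have "E P (\<lambda>s. (\<Sum>k<N. fst (s k) * t (snd (s k)))\<^sup>2) \<le>
      E ?H (\<lambda>h. ?W\<^sup>2 + (\<Sum>i\<in>I. \<Sum>j\<in>I. w i * w j * (t i)\<^sup>2 * (h j / h i)) / real N)"
    unfolding EP using I N w t H finH by (intro expectation_mono_finite resample_moments)
  also have "\<dots> = ?W\<^sup>2 + (\<Sum>i\<in>I. \<Sum>j\<in>I. w i * w j * ((t i)\<^sup>2 * E ?H (\<lambda>h. h j / h i))) / real N"
    by (simp add: Bochner_Integration.integral_add[OF int int] Bochner_Integration.integral_sum[OF int]
        mult.assoc del: times_divide_eq_right)
  also have "\<dots> \<le> ?W\<^sup>2 + (\<Sum>i\<in>I. \<Sum>j\<in>I. w i * w j * (\<beta> * \<gamma> * (t i * t j))) / real N"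
    using ratio w by (intro add_left_mono divide_right_mono sum_mono mult_left_mono) auto
  also have "(\<Sum>i\<in>I. \<Sum>j\<in>I. w i * w j * (\<beta> * \<gamma> * (t i * t j))) = \<beta> * \<gamma> * ?W\<^sup>2"
    by (simp add: power2_eq_square sum_product sum_distrib_left mult_ac)
  finally show "E P (\<lambda>s. (\<Sum>k<N. fst (s k) * t (snd (s k)))\<^sup>2) \<le> (1 + \<beta> * \<gamma> / real N) * ?W\<^sup>2"
    by (simp add: algebra_simps)
qed

text \<open>Resampling acts on pairs (particle, child index), which become cells only afterwards, so
  one cell reached from two particles gets two independent estimates. Children inherit the weight of
  their parent.\<close>

definition particle_step ::
  "nat \<Rightarrow> 'j set \<Rightarrow> ('c \<Rightarrow> 'j \<Rightarrow> 'c) \<Rightarrow> ('c \<Rightarrow> real pmf) \<Rightarrow> (nat \<Rightarrow> real \<times> 'c) \<Rightarrow> (nat \<Rightarrow> real \<times> 'c) pmf" where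
  "particle_step N J ch coarse s =
     map_pmf (\<lambda>s' k. (fst (s' k), case snd (s' k) of (i, j) \<Rightarrow> ch (snd (s i)) j))
       (bind_pmf (Pi_pmf ({..<N} \<times> J) 0 (\<lambda>(i, j). coarse (ch (snd (s i)) j)))
         (resample N ({..<N} \<times> J) (\<lambda>(i, j). fst (s i))))"

text \<open>The counter is the number of levels left. A step from height \<open>Suc k\<close> uses
  the estimator for children at height \<open>k\<close>, and at height 0 the counts are read off by
  \<open>leaf\<close>.\<close>

primrec particle_run ::
  "nat \<Rightarrow> 'j set \<Rightarrow> ('c \<Rightarrow> 'j \<Rightarrow> 'c) \<Rightarrow> (nat \<Rightarrow> 'c \<Rightarrow> real pmf) \<Rightarrow> ('c \<Rightarrow> real pmf) \<Rightarrow> nat \<Rightarrow>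
     (nat \<Rightarrow> real \<times> 'c) \<Rightarrow> real pmf" where
  "particle_run N J ch coarse leaf 0 s =
     map_pmf (\<lambda>y. \<Sum>i<N. fst (s i) * y i) (Pi_pmf {..<N} 0 (\<lambda>i. leaf (snd (s i))))"
| "particle_run N J ch coarse leaf (Suc k) s =
     bind_pmf (particle_step N J ch (coarse k) s) (particle_run N J ch coarse leaf k)"

text \<open>Condition on the state after one step: the induction hypothesis covers the remaining
  levels, and \<open>coarse_resample_moments\<close> contributes one more factor
  \<open>1 + \<beta> * \<gamma> / N\<close>.\<close>

lemma particle_run_moments:
  fixes T :: "nat \<Rightarrow> 'c \<Rightarrow> real"
  assumes J: "finite J" "J \<noteq> {}" and N: "N > 0"
    and T: "\<And>k x. T k x \<ge> 0" "\<And>k x. T (Suc k) x = (\<Sum>j\<in>J. T k (ch x j))"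
    and coarse: "\<And>k x. coarse_estimate \<beta> \<gamma> (T k x) (coarse k x)"
    and leaf: "\<And>x. leaf x = return_pmf (T 0 x)"
    and bc: "\<beta> * \<gamma> \<ge> 1" "\<beta> \<ge> 0" "\<gamma> \<ge> 0"
    and s: "\<And>i. i < N \<Longrightarrow> fst (s i) \<ge> 0"
  shows "finite (set_pmf (particle_run N J ch coarse leaf k s)) \<and>
    E (particle_run N J ch coarse leaf k s) (\<lambda>x. x) = (\<Sum>i<N. fst (s i) * T k (snd (s i))) \<and>
    E (particle_run N J ch coarse leaf k s) (\<lambda>x. x\<^sup>2)
      \<le> (1 + \<beta> * \<gamma> / real N) ^ k * (\<Sum>i<N. fst (s i) * T k (snd (s i)))\<^sup>2"
  using s
proof (induction k arbitrary: s)
  case 0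
  then show ?case by (simp add: leaf)
next
  case (Suc k)
  let ?R = "particle_run N J ch coarse leaf"
  let ?I = "{..<N} \<times> J"
  let ?w = "\<lambda>(i, j :: 'b). fst (s i)"
  let ?t = "\<lambda>(i, j). T k (ch (snd (s i)) j)"
  let ?C = "\<lambda>(i, j). coarse k (ch (snd (s i)) j)"
  let ?W = "\<lambda>k s. \<Sum>i<N. fst (s i) * T k (snd (s i))"
  let ?S = "particle_step N J ch (coarse k) s"
  let ?P = "bind_pmf (Pi_pmf ?I 0 ?C) (resample N ?I ?w)"
  let ?\<rho> = "1 + \<beta> * \<gamma> / real N"
  have I: "finite ?I" "?I \<noteq> {}"
    using J N by auto
  have finC: "finite (set_pmf (?C i))" for i
    using coarse by (auto simp: coarse_estimate_def split: prod.split)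
  have finS: "finite (set_pmf ?S)"
    using finite_set_Pi_pmf[OF I(1) finC] finite_set_resample[OF I] by (simp add: particle_step_def)
  \<comment> \<open>The induction hypothesis asks for nonnegative weights, so a step has to preserve
    them.\<close>
  have pos: "fst (s' i) \<ge> 0" if s': "s' \<in> set_pmf ?S" and i: "i < N" for s' i
  proof -
    obtain h s'' where h: "h \<in> set_pmf (Pi_pmf ?I 0 ?C)" and s'': "s'' \<in> set_pmf (resample N ?I ?w h)"
      and eq: "fst (s' i) = fst (s'' i)"
      using s' by (auto simp: particle_step_def)
    have h0: "h x \<ge> 0" if "x \<in> ?I" for x
      using set_Pi_pmf_component[OF I(1) h that] coarse
      by (auto simp: coarse_estimate_def split: prod.splits)
    have "fst (s'' i) = (\<Sum>i\<in>?I. ?w i * h i) / (real N * h (snd (s'' i)))"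
      using set_resample[OF I s'' i] by simp
    also have "\<dots> \<ge> 0"
      using h0 Suc.prems set_resample(1)[OF I s'' i]
      by (intro divide_nonneg_nonneg sum_nonneg mult_nonneg_nonneg) auto
    finally show ?thesis by (simp add: eq)
  qed
  \<comment> \<open>Splitting the cells leaves the weighted count unchanged.\<close>
  have W: "(\<Sum>i\<in>?I. ?w i * ?t i) = ?W (Suc k) s"
    by (simp add: T(2) sum_distrib_left sum.cartesian_product case_prod_unfold)
  have ES: "E ?S (\<lambda>s'. f (?W k s')) = E ?P (\<lambda>s'. f (\<Sum>k<N. fst (s' k) * ?t (snd (s' k))))"
    for f :: "real \<Rightarrow> real"
    by (simp add: particle_step_def case_prod_unfold)
  have M: "E ?P (\<lambda>s. \<Sum>k<N. fst (s k) * ?t (snd (s k))) = (\<Sum>i\<in>?I. ?w i * ?t i)"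
    "E ?P (\<lambda>s. (\<Sum>k<N. fst (s k) * ?t (snd (s k)))\<^sup>2) \<le> ?\<rho> * (\<Sum>i\<in>?I. ?w i * ?t i)\<^sup>2"
    by (rule coarse_resample_moments[where \<beta> = \<beta> and \<gamma> = \<gamma>];
        use I N Suc.prems T coarse bc in \<open>auto split: prod.split\<close>)+
  have IH: "finite (set_pmf (?R k s'))" "E (?R k s') (\<lambda>x. x) = ?W k s'"
    "E (?R k s') (\<lambda>x. x\<^sup>2) \<le> ?\<rho> ^ k * (?W k s')\<^sup>2" if "s' \<in> set_pmf ?S" for s'
    using Suc.IH[of s'] pos[OF that] by auto
  have ER: "E (?R (Suc k) s) f = E ?S (\<lambda>s'. E (?R k s') f)" for f :: "real \<Rightarrow> real"
    using finS IH(1) by (simp add: expectation_bind_finite)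
  have "E (?R (Suc k) s) (\<lambda>x. x) = E ?S (?W k)"
    unfolding ER using IH(2) by (intro expectation_cong)
  also have "\<dots> = ?W (Suc k) s"
    using ES[of "\<lambda>x. x"] M(1) W by simp
  finally have 1: "E (?R (Suc k) s) (\<lambda>x. x) = ?W (Suc k) s" .
  have "E (?R (Suc k) s) (\<lambda>x. x\<^sup>2) \<le> E ?S (\<lambda>s'. ?\<rho> ^ k * (?W k s')\<^sup>2)"
    unfolding ER using finS IH(3) by (intro expectation_mono_finite)
  also have "\<dots> = ?\<rho> ^ k * E ?P (\<lambda>s. (\<Sum>k<N. fst (s k) * ?t (snd (s k)))\<^sup>2)"
    using ES[of "\<lambda>x. x\<^sup>2"] by simp
  also have "\<dots> \<le> ?\<rho> ^ k * (?\<rho> * (?W (Suc k) s)\<^sup>2)"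
    using M(2) bc unfolding W by (intro mult_left_mono) auto
  finally have 2: "E (?R (Suc k) s) (\<lambda>x. x\<^sup>2) \<le> ?\<rho> ^ Suc k * (?W (Suc k) s)\<^sup>2"
    by (simp add: mult_ac)
  have "finite (set_pmf (?R (Suc k) s))"
    using finS IH(1) by simp
  with 1 2 show ?case by blast
qed

section \<open>Coarse estimates\<close>

text \<open>Intersecting with the supports makes both sets countable, as
  \<open>measure_pmf_prob_product\<close> demands.\<close>

lemma measure_pair_pmf_Times:
  "measure_pmf.prob (pair_pmf M N) (A \<times> B) = measure_pmf.prob M A * measure_pmf.prob N B"
proof -
  have "measure_pmf.prob (pair_pmf M N) (A \<times> B) =
      measure_pmf.prob (pair_pmf M N) ((A \<inter> set_pmf M) \<times> (B \<inter> set_pmf N))"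
    by (subst measure_Int_set_pmf[symmetric]) (auto intro!: arg_cong[where f = "measure _"])
  also have "\<dots> = measure_pmf.prob M (A \<inter> set_pmf M) * measure_pmf.prob N (B \<inter> set_pmf N)"
    by (intro measure_pmf_prob_product) auto
  finally show ?thesis by (simp add: measure_Int_set_pmf)
qed

section \<open>Random subsets and dyadic scales\<close>

definition random_subset :: "'v set \<Rightarrow> real \<Rightarrow> 'v set pmf" where
  "random_subset A p = map_pmf (\<lambda>f. {a\<in>A. f a}) (Pi_pmf A False (\<lambda>_. bernoulli_pmf p))"

lemma set_random_subset: "S \<in> set_pmf (random_subset A p) \<Longrightarrow> S \<subseteq> A"
  by (auto simp: random_subset_def)

lemma bernoulli_pmf_1: "bernoulli_pmf 1 = return_pmf True"
  by (rule pmf_eqI) (case_tac i; simp)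

lemma random_subset_1: "finite A \<Longrightarrow> random_subset A 1 = return_pmf A"
  by (simp add: random_subset_def bernoulli_pmf_1 cong: conj_cong)

lemma prob_random_subset_disjoint:
  assumes "finite A" "H \<subseteq> A" "0 \<le> p" "p \<le> 1"
  shows "measure_pmf.prob (random_subset A p) {S. S \<inter> H = {}} = (1 - p) ^ card H"
proof -
  have "measure_pmf.prob (random_subset A p) {S. S \<inter> H = {}} =
      measure_pmf.prob (Pi_pmf A False (\<lambda>_. bernoulli_pmf p))
        (Pi A (\<lambda>a. if a \<in> H then {False} else UNIV))"
    using assms(2) unfolding random_subset_def measure_map_pmf
    by (intro arg_cong[where f = "measure _"]) (auto simp: Pi_def)
  also have "\<dots> = (\<Prod>a\<in>A. if a \<in> H then 1 - p else 1)"
    using assms unfolding measure_Pi_pmf_Pi[OF assms(1)]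
    by (intro prod.cong) (auto simp: measure_pmf_single)
  also have "\<dots> = (1 - p) ^ card H"
    using assms by (simp add: prod.If_cases Int_absorb1)
  finally show ?thesis .
qed

lemma prob_random_subset_mem:
  assumes "finite A" "a \<in> A" "0 \<le> p" "p \<le> 1"
  shows "measure_pmf.prob (random_subset A p) {S. a \<in> S} = p"
proof -
  have "{S. S \<inter> {a} = {}} = UNIV - {S. a \<in> S}" by auto
  with prob_random_subset_disjoint[of A "{a}" p] assms show ?thesis
    by (simp add: measure_pmf.prob_compl[simplified])
qed

text \<open>With \<open>u = 2 ^ - x\<close>,
  \<open>(1 - u) ^ m \<le> exp (- u * m) \<le> exp (- 1) \<le> 1 / 2\<close>. Hence sampling at rate
  \<open>u\<close> hits a set of at least \<open>2 ^ x\<close> elements with probability at least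
  one half.\<close>

lemma one_minus_power_le_half:
  assumes "2 ^ x \<le> m"
  shows "(1 - 1 / 2 ^ x :: real) ^ m \<le> 1 / 2"
proof -
  have "(1 - 1 / 2 ^ x :: real) ^ m \<le> exp (- (1 / 2 ^ x)) ^ m"
    using exp_ge_add_one_self[of "- (1 / 2 ^ x)"] by (intro power_mono) auto
  also have "\<dots> = exp (- (real m / 2 ^ x))"
    by (simp flip: exp_of_nat_mult)
  also have "\<dots> \<le> exp (- 1)"
    using assms by (simp add: le_divide_eq)
  also have "\<dots> \<le> 1 / 2"
    using exp_ge_add_one_self[of 1] by (simp add: exp_minus field_simps)
  finally show ?thesis .
qed

text \<open>If \<open>2 ^ j\<close> is the largest power of two below or equal to a positive
  \<open>k\<close>, the sum equals \<open>2 ^ (j + 1) - 1\<close>, which is at least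
  \<open>k\<close>.\<close>

lemma le_sum_powers_of_2:
  fixes k :: nat
  assumes "k < 2 ^ Suc l"
  shows "k \<le> (\<Sum>i\<le>l. if 2 ^ i \<le> k then 2 ^ i else 0)"
  using assms
proof (induction l)
  case (Suc l)
  show ?case
  proof (cases "k < 2 ^ Suc l")
    case True
    with Suc.IH show ?thesis by simp
  next
    case False
    then have "2 ^ i \<le> k" if "i \<le> Suc l" for i
      using that power_increasing[of i "Suc l" "2 :: nat"] by linarith
    then have "(\<Sum>i\<le>Suc l. if 2 ^ i \<le> k then 2 ^ i else 0) = (\<Sum>i\<le>Suc l. 2 ^ i :: nat)"
      by (intro sum.cong) auto
    also have "\<dots> = 2 ^ Suc (Suc l) - 1"
      by (induction l) auto
    finally show ?thesis using Suc.prems by simp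
  qed
qed (auto simp: numeral_2_eq_2 less_Suc_eq)

section \<open>Density tests and the estimate built from them\<close>

definition triples :: "('v \<Rightarrow> 'v \<Rightarrow> 'v \<Rightarrow> bool) \<Rightarrow> 'v set \<Rightarrow> 'v set \<Rightarrow> 'v set \<Rightarrow> ('v \<times> 'v \<times> 'v) set" where
  "triples P A B C = {(a, b, c). a \<in> A \<and> b \<in> B \<and> c \<in> C \<and> P a b c}"

lemma finite_triples: "finite A \<Longrightarrow> finite B \<Longrightarrow> finite C \<Longrightarrow> finite (triples P A B C)"
  by (rule finite_subset[of _ "A \<times> B \<times> C"]) (auto simp: triples_def)

lemma card_triples_le:
  assumes "finite A" "finite B" "finite C"
  shows "card (triples P A B C) \<le> card A * card B * card C"
proof -
  have "card (triples P A B C) \<le> card (A \<times> B \<times> C)"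
    using assms by (intro card_mono) (auto simp: triples_def)
  then show ?thesis by (simp add: card_cartesian_product)
qed

definition density_test ::
  "('v set \<Rightarrow> 'v set \<Rightarrow> 'v set \<Rightarrow> bool) \<Rightarrow> 'v set \<Rightarrow> 'v set \<Rightarrow> 'v set \<Rightarrow> nat \<Rightarrow> nat \<Rightarrow> bool pmf" where
  "density_test Q A B C x y =
     bind_pmf (random_subset A (1 / 2 ^ x)) (\<lambda>A'.
       bind_pmf (random_subset B (1 / 2 ^ y)) (\<lambda>B'. return_pmf (Q A' B' C)))"

text \<open>Union bound over the triples: each survives with probability
  \<open>2 ^ - (x + y)\<close>, since the two random subsets are independent.\<close>

lemma prob_density_test_le:
  assumes fin: "finite A" "finite B" "finite C"
    and Q: "\<And>A' B'. A' \<subseteq> A \<Longrightarrow> B' \<subseteq> B \<Longrightarrow> Q A' B' C \<longleftrightarrow> triples P A' B' C \<noteq> {}"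
  shows "pmf (density_test Q A B C x y) True \<le> card (triples P A B C) / 2 ^ (x + y)"
proof -
  let ?A = "random_subset A (1 / 2 ^ x)" and ?B = "random_subset B (1 / 2 ^ y)"
  let ?T = "triples P A B C"
  have eq: "density_test Q A B C x y = map_pmf (\<lambda>(A', B'). Q A' B' C) (pair_pmf ?A ?B)"
    by (simp add: density_test_def pair_pmf_def map_bind_pmf)
  have "pmf (density_test Q A B C x y) True =
      measure_pmf.prob (pair_pmf ?A ?B) {(A', B'). Q A' B' C}"
    unfolding eq pmf_map by (intro arg_cong[where f = "measure _"]) auto
  also have "\<dots> = measure_pmf.prob (pair_pmf ?A ?B) ({(A', B'). Q A' B' C} \<inter> set_pmf (pair_pmf ?A ?B))"
    by (rule measure_Int_set_pmf[symmetric])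
  also have "\<dots> \<le> measure_pmf.prob (pair_pmf ?A ?B) (\<Union>(a, b, c)\<in>?T. {A'. a \<in> A'} \<times> {B'. b \<in> B'})"
  proof (intro measure_pmf.finite_measure_mono subsetI)
    fix z assume z: "z \<in> {(A', B'). Q A' B' C} \<inter> set_pmf (pair_pmf ?A ?B)"
    obtain A' B' where [simp]: "z = (A', B')" by (cases z)
    from z have sub: "A' \<subseteq> A" "B' \<subseteq> B" and "Q A' B' C"
      using set_random_subset[of A' A] set_random_subset[of B' B] by auto
    then obtain a b c where "(a, b, c) \<in> triples P A' B' C"
      using Q by fastforce
    then show "z \<in> (\<Union>(a, b, c)\<in>?T. {A'. a \<in> A'} \<times> {B'. b \<in> B'})"
      using sub by (force simp: triples_def)
  qed auto
  also have "\<dots> \<le> (\<Sum>t\<in>?T. measure_pmf.prob (pair_pmf ?A ?B)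
      (case t of (a, b, c) \<Rightarrow> {A'. a \<in> A'} \<times> {B'. b \<in> B'}))"
    using fin by (intro measure_UNION_le finite_triples) auto
  also have "\<dots> = (\<Sum>t\<in>?T. 1 / 2 ^ (x + y))"
    using fin by (intro sum.cong)
      (auto simp: triples_def measure_pair_pmf_Times prob_random_subset_mem power_add)
  finally show ?thesis by simp
qed

text \<open>
  Let \<open>dg a\<close> be the number of \<open>b\<close> for which some triple \<open>(a, b, _)\<close> exists. Bucketing the \<open>a\<close> by the
  dyadic size of \<open>dg a\<close> yields a scale \<open>2 ^ y\<close> at which the \<open>a\<close> with \<open>dg a \<ge> 2 ^ y\<close> carry a
  \<open>1 / (l + 1)\<close> fraction of all pairs \<open>(a, b)\<close>; the rate \<open>2 ^ - x\<close> is matched to the number of such \<open>a\<close>.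
\<close>
lemma ex_prob_density_test_ge:
  assumes fin: "finite A" "finite B" "finite C"
    and card: "card A \<le> 2 ^ l" "card B \<le> 2 ^ l"
    and Q: "\<And>A' B'. A' \<subseteq> A \<Longrightarrow> B' \<subseteq> B \<Longrightarrow> Q A' B' C \<longleftrightarrow> triples P A' B' C \<noteq> {}"
    and d: "\<And>a b. a \<in> A \<Longrightarrow> b \<in> B \<Longrightarrow> card {c\<in>C. P a b c} \<le> d"
    and ne: "triples P A B C \<noteq> {}"
  shows "\<exists>x\<le>l. \<exists>y\<le>l. pmf (density_test Q A B C x y) True \<ge> 1 / 4 \<and>
           card (triples P A B C) \<le> 2 * d * (l + 1) * 2 ^ (x + y)"
proof -
  define Nb where "Nb a = {b\<in>B. \<exists>c\<in>C. P a b c}" for a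
  define H where "H i = {a\<in>A. 2 ^ i \<le> card (Nb a)}" for i :: nat
  have Nb: "Nb a \<subseteq> B" "finite (Nb a)" "card (Nb a) \<le> 2 ^ l" for a
    using fin card card_mono[of B "Nb a"] by (auto simp: Nb_def)
  have "triples P A B C = (SIGMA a:A. SIGMA b:Nb a. {c\<in>C. P a b c})"
    by (auto simp: triples_def Nb_def)
  then have "card (triples P A B C) = (\<Sum>a\<in>A. \<Sum>b\<in>Nb a. card {c\<in>C. P a b c})"
    using fin Nb by simp
  also have "\<dots> \<le> (\<Sum>a\<in>A. \<Sum>b\<in>Nb a. d)"
    using d Nb by (intro sum_mono) (auto simp: Nb_def)
  also have "\<dots> = d * (\<Sum>a\<in>A. card (Nb a))"
    by (simp add: sum_distrib_left mult.commute)
  \<comment> \<open>Each degree is replaced by the sum of the powers of two up to it; exchanging the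
    sums then groups the vertices by scale.\<close>
  also have "(\<Sum>a\<in>A. card (Nb a)) \<le> (\<Sum>a\<in>A. \<Sum>i\<le>l. if 2 ^ i \<le> card (Nb a) then 2 ^ i else 0)"
  proof (intro sum_mono le_sum_powers_of_2)
    show "card (Nb a) < 2 ^ Suc l" for a
      using Nb(3)[of a] by (simp add: le_less_trans)
  qed
  also have "\<dots> = (\<Sum>i\<le>l. \<Sum>a\<in>A. if 2 ^ i \<le> card (Nb a) then 2 ^ i else 0)"
    by (rule sum.swap)
  also have "\<dots> = (\<Sum>i\<le>l. 2 ^ i * card (H i))"
    using fin by (intro sum.cong) (auto simp: H_def sum.If_cases Int_def)
  finally have T: "card (triples P A B C) \<le> d * (\<Sum>i\<le>l. 2 ^ i * card (H i))"
    by simp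
  \<comment> \<open>The scale \<open>y\<close> attaining the maximum carries at least a
    \<open>1 / (l + 1)\<close> fraction of the sum.\<close>
  define M where "M = Max ((\<lambda>i. 2 ^ i * card (H i)) ` {..l})"
  have "M \<in> (\<lambda>i. 2 ^ i * card (H i)) ` {..l}"
    unfolding M_def by (rule Max_in) auto
  then obtain y where y: "y \<le> l" "M = 2 ^ y * card (H y)"
    by auto
  have "(\<Sum>i\<le>l. 2 ^ i * card (H i)) \<le> (\<Sum>i\<le>l. M)"
    unfolding M_def by (intro sum_mono Max_ge) auto
  with T have T2: "card (triples P A B C) \<le> d * ((l + 1) * (2 ^ y * card (H y)))"
    unfolding y(2) by (auto elim: order_trans)
  moreover have "card (triples P A B C) > 0"
    using ne fin finite_triples by (metis card_gt_0_iff)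
  ultimately have "card (H y) \<ge> 1"
    by (cases "card (H y)") auto
  \<comment> \<open>\<open>2 ^ x\<close> is \<open>card (H y)\<close> rounded down to a power of
    two: the lower bound serves the hitting probability, the upper bound the count, where the
    rounding costs the factor 2.\<close>
  then obtain x where x: "2 ^ x \<le> card (H y)" "card (H y) < 2 ^ (x + 1)"
    using ex_power_ivl1[of 2 "card (H y)"] by auto
  have Hsub: "H y \<subseteq> A" by (auto simp: H_def)
  have "2 ^ x \<le> (2 :: nat) ^ l"
    using x(1) card(1) card_mono[OF fin(1) Hsub] by linarith
  then have xl: "x \<le> l" by simp
  have "card (triples P A B C) \<le> d * ((l + 1) * (2 ^ y * 2 ^ (x + 1)))"
    using T2 x(2) by (elim order_trans) (intro mult_left_mono; simp)
  also have "\<dots> = 2 * d * (l + 1) * 2 ^ (x + y)"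
    by (simp add: power_add algebra_simps)
  finally have bound: "card (triples P A B C) \<le> 2 * d * (l + 1) * 2 ^ (x + y)" .
  let ?A = "random_subset A (1 / 2 ^ x)" and ?B = "random_subset B (1 / 2 ^ y)"
  let ?F = "\<lambda>A'. pmf (bind_pmf ?B (\<lambda>B'. return_pmf (Q A' B' C))) True"
  \<comment> \<open>Once some \<open>a\<close> of \<open>H y\<close> has survived, it has at least
    \<open>2 ^ y\<close> neighbours in \<open>B\<close>, and one of them survives with probability
    at least one half.\<close>
  have inner: "?F A' \<ge> 1 / 2" if A': "A' \<subseteq> A" "A' \<inter> H y \<noteq> {}" for A'
  proof -
    obtain a where a: "a \<in> A'" "a \<in> H y"
      using A' by auto
    have "measure_pmf.prob ?B {S. S \<inter> Nb a = {}} \<le> 1 / 2"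
      using a(2) fin Nb(1)[of a] one_minus_power_le_half[of y "card (Nb a)"]
      by (subst prob_random_subset_disjoint) (auto simp: H_def)
    moreover have "{S. S \<inter> Nb a \<noteq> {}} = UNIV - {S. S \<inter> Nb a = {}}" by auto
    ultimately have "1 / 2 \<le> measure_pmf.prob ?B {S. S \<inter> Nb a \<noteq> {}}"
      by (simp add: measure_pmf.prob_compl[simplified])
    also have "\<dots> = measure_pmf.prob ?B ({S. S \<inter> Nb a \<noteq> {}} \<inter> set_pmf ?B)"
      by (simp add: measure_Int_set_pmf)
    also have "\<dots> \<le> measure_pmf.prob ?B {S. Q A' S C}"
    proof (intro measure_pmf.finite_measure_mono subsetI)
      fix S assume S: "S \<in> {S. S \<inter> Nb a \<noteq> {}} \<inter> set_pmf ?B"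
      then have "S \<subseteq> B"
        using set_random_subset by blast
      moreover from S obtain b c where "b \<in> S" "c \<in> C" "P a b c"
        by (auto simp: Nb_def)
      ultimately show "S \<in> {S. Q A' S C}"
        using Q[OF A'(1), of S] a(1) by (auto simp: triples_def)
    qed auto
    also have "\<dots> = ?F A'"
      unfolding map_pmf_def[symmetric] pmf_map by (intro arg_cong[where f = "measure _"]) auto
    finally show ?thesis .
  qed
  have "measure_pmf.prob ?A {S. S \<inter> H y = {}} \<le> 1 / 2"
    using fin Hsub x(1) one_minus_power_le_half[of x "card (H y)"]
    by (subst prob_random_subset_disjoint) auto
  moreover have "{S. S \<inter> H y \<noteq> {}} = UNIV - {S. S \<inter> H y = {}}" by auto
  ultimately have "1 / 2 \<le> measure_pmf.prob ?A {S. S \<inter> H y \<noteq> {}}"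
    by (simp add: measure_pmf.prob_compl[simplified])
  then have "1 / 4 \<le> E ?A (\<lambda>S. 1 / 2 * (indicator {S. S \<inter> H y \<noteq> {}} S :: real))"
    by simp
  also have "\<dots> \<le> E ?A ?F"
  proof (intro expectation_mono_finite)
    show "finite (set_pmf ?A)"
      using fin set_random_subset by (metis finite_Pow_iff finite_subset PowI subsetI)
    show "1 / 2 * indicator {S. S \<inter> H y \<noteq> {}} S \<le> ?F S" if "S \<in> set_pmf ?A" for S
      using inner[of S] set_random_subset[OF that] by (auto simp: indicator_def)
  qed
  also have "\<dots> = pmf (density_test Q A B C x y) True"
    by (simp add: density_test_def pmf_bind)
  finally show ?thesis
    using xl y(1) bound by blast
qed

text \<open>A successful test at scale \<open>(x, y)\<close> votes for the count
  \<open>2 ^ (x + y)\<close>. Adding the votes makes the mean easy to bound, and the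
  \<open>R\<close> repetitions make it unlikely that a good scale is missed.\<close>

definition density_estimate ::
  "('v set \<Rightarrow> 'v set \<Rightarrow> 'v set \<Rightarrow> bool) \<Rightarrow> nat \<Rightarrow> nat \<Rightarrow> 'v set \<Rightarrow> 'v set \<Rightarrow> 'v set \<Rightarrow> real pmf" where
  "density_estimate Q l R A B C =
     map_pmf (\<lambda>h. \<Sum>j\<in>{..l} \<times> {..l} \<times> {..<R}. case j of (x, y, r) \<Rightarrow> 2 ^ (x + y) * of_bool (h j))
       (Pi_pmf ({..l} \<times> {..l} \<times> {..<R}) False (\<lambda>(x, y, r). density_test Q A B C x y))"

text \<open>Each of the \<open>(l + 1)^2 * R\<close> tests adds at most the true count to the mean.
  For the mean of \<open>1 / c\<close>: a success at the good scale makes \<open>c\<close> at least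
  the count divided by \<open>2 * d * (l + 1)\<close>; if all \<open>R\<close> tests there fail,
  which has probability at most \<open>(3 / 4) ^ R\<close>, the bound \<open>c \<ge> 1\<close>
  suffices.\<close>

lemma coarse_estimate_density_estimate:
  assumes fin: "finite A" "finite B" "finite C"
    and card: "card A \<le> 2 ^ l" "card B \<le> 2 ^ l"
    and Q: "\<And>A' B'. A' \<subseteq> A \<Longrightarrow> B' \<subseteq> B \<Longrightarrow> Q A' B' C \<longleftrightarrow> triples P A' B' C \<noteq> {}"
    and d: "\<And>a b. a \<in> A \<Longrightarrow> b \<in> B \<Longrightarrow> card {c\<in>C. P a b c} \<le> d"
    and R: "R > 0" "card (triples P A B C) * (3 / 4) ^ R \<le> (1 :: real)"
  shows "coarse_estimate (2 * d * (l + 1) + 1) ((l + 1)\<^sup>2 * R) (card (triples P A B C))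
           (density_estimate Q l R A B C)"
proof -
  let ?J = "{..l} \<times> {..l} \<times> {..<R}"
  let ?T = "card (triples P A B C)"
  let ?D = "density_test Q A B C"
  let ?p = "\<lambda>(x, y, r :: nat). ?D x y"
  let ?P = "Pi_pmf ?J False ?p"
  let ?val = "\<lambda>h :: nat \<times> nat \<times> nat \<Rightarrow> bool. \<Sum>j\<in>?J. case j of (x, y, r) \<Rightarrow> 2 ^ (x + y) * (of_bool (h j) :: real)"
  have finP: "finite (set_pmf ?P)"
    by (intro finite_set_Pi_pmf) auto
  have int: "integrable ?P F" for F :: "_ \<Rightarrow> real"
    using finP by (intro integrable_measure_pmf_finite)
  have EC: "E (density_estimate Q l R A B C) f = E ?P (\<lambda>h. f (?val h))" for f :: "real \<Rightarrow> real"
    by (simp add: density_estimate_def)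
  have val0: "?val h \<ge> 0" for h
    by (intro sum_nonneg) auto
  have val_ge: "?val h \<ge> 2 ^ (x + y)" if "x \<le> l" "y \<le> l" "r < R" "h (x, y, r)" for h x y r
  proof -
    have "(case (x, y, r) of (x', y', r') \<Rightarrow> 2 ^ (x' + y') * (of_bool (h (x, y, r)) :: real)) \<le> ?val h"
      using that by (intro member_le_sum[where i = "(x, y, r)" and A = ?J
          and f = "\<lambda>j. case j of (x, y, r) \<Rightarrow> 2 ^ (x + y) * of_bool (h j)"]) auto
    with that show ?thesis by simp
  qed
  have ED: "E (?D x y) of_bool = pmf (?D x y) True" for x y
    by (subst integral_measure_pmf[of "{True}"]) auto
  have "E (density_estimate Q l R A B C) (\<lambda>c. c) =
      (\<Sum>j\<in>?J. case j of (x, y, r) \<Rightarrow> 2 ^ (x + y) * E ?P (\<lambda>h. of_bool (h j)))"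
    unfolding EC by (subst Bochner_Integration.integral_sum[OF int]) (auto intro!: sum.cong)
  also have "\<dots> \<le> (\<Sum>j\<in>?J. real ?T)"
  proof (intro sum_mono)
    fix j assume j: "j \<in> ?J"
    obtain x y r where [simp]: "j = (x, y, r)" by (cases j) auto
    have "E ?P (\<lambda>h. of_bool (h j)) = pmf (?D x y) True"
      using j expectation_Pi_pmf_component[of ?J j False ?p of_bool] by (simp add: ED)
    also have "\<dots> \<le> ?T / 2 ^ (x + y)"
      by (intro prob_density_test_le fin Q)
    finally show "(case j of (x, y, r) \<Rightarrow> 2 ^ (x + y) * E ?P (\<lambda>h. of_bool (h j))) \<le> real ?T"
      by (simp add: field_simps)
  qed
  also have "\<dots> = (l + 1)\<^sup>2 * R * ?T"
    by (simp add: card_cartesian_product power2_eq_square algebra_simps)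
  finally have 1: "E (density_estimate Q l R A B C) (\<lambda>c. c) \<le> (l + 1)\<^sup>2 * R * ?T" by simp
  have 2: "?val h \<ge> 1" if "?T > 0" "h \<in> set_pmf ?P" for h
  proof -
    \<comment> \<open>At \<open>x = y = 0\<close> nothing is discarded, so this test always succeeds
      on a nonempty cell and keeps \<open>1 / c\<close> bounded.\<close>
    have "?D 0 0 = return_pmf True"
      using that(1) Q[of A B] fin by (auto simp: density_test_def random_subset_1 bind_return_pmf)
    with set_Pi_pmf_component[OF _ that(2), of "(0, 0, 0)"] R(1) have "h (0, 0, 0)"
      by simp
    with val_ge[of 0 0 0 h] R(1) show ?thesis by simp
  qed
  have 3: "E (density_estimate Q l R A B C) (\<lambda>c. 1 / c) \<le> (2 * d * (l + 1) + 1) / ?T" if T: "?T > 0"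
  proof -
    from T have "triples P A B C \<noteq> {}" by auto
    with ex_prob_density_test_ge[of A B C l Q P d] fin card Q d obtain x y where xy: "x \<le> l" "y \<le> l"
      "pmf (?D x y) True \<ge> 1 / 4" "?T \<le> 2 * d * (l + 1) * 2 ^ (x + y)"
      by blast
    \<comment> \<open>All \<open>R\<close> tests at the good scale fail; the other tests are
      unconstrained.\<close>
    let ?bad = "Pi ?J (\<lambda>(x', y', r). if x' = x \<and> y' = y then {False} else UNIV)"
    have "1 / ?val h \<le> 1 / 2 ^ (x + y) + indicator ?bad h" if h: "h \<in> set_pmf ?P" for h
    proof (cases "h \<in> ?bad")
      case True
      then show ?thesis
        using 2[OF T h] by (simp add: divide_le_eq_1 add_increasing)
    next
      case False
      then obtain r where "r < R" "h (x, y, r)"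
        by (auto simp: Pi_def split: if_splits)
      with val_ge[of x y r h] xy have "?val h \<ge> 2 ^ (x + y)" by simp
      then show ?thesis
        using False by (simp add: frac_le)
    qed
    then have "E (density_estimate Q l R A B C) (\<lambda>c. 1 / c) \<le> E ?P (\<lambda>h. 1 / 2 ^ (x + y) + indicator ?bad h)"
      unfolding EC using finP by (intro expectation_mono_finite)
    also have "\<dots> = 1 / 2 ^ (x + y) + measure_pmf.prob ?P ?bad"
      by (subst Bochner_Integration.integral_add[OF int int]) simp
    also have "measure_pmf.prob ?P ?bad =
        (\<Prod>j\<in>?J. if j \<in> {x} \<times> {y} \<times> {..<R} then pmf (?D x y) False else 1)"
      by (subst measure_Pi_pmf_Pi, simp, intro prod.cong refl)
        (auto simp: measure_pmf_single split: if_split_asm)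
    also have "\<dots> = pmf (?D x y) False ^ R"
    proof -
      have "?J \<inter> ({x} \<times> {y} \<times> {..<R}) = {x} \<times> {y} \<times> {..<R}"
        using xy by auto
      then show ?thesis
        by (simp add: prod.If_cases card_cartesian_product)
    qed
    also have "\<dots> \<le> (3 / 4) ^ R"
      using xy(3) by (intro power_mono) (simp_all add: pmf_False_conv_True pmf_le_1)
    also have "\<dots> \<le> 1 / ?T"
      using R(2) T by (simp add: field_simps)
    also have "1 / 2 ^ (x + y) \<le> 2 * d * (l + 1) / ?T"
    proof -
      have "real ?T \<le> real (2 * d * (l + 1) * 2 ^ (x + y))"
        using xy(4) of_nat_le_iff by blast
      then show ?thesis
        using T by (simp add: field_simps)
    qed
    finally show ?thesis
      by (simp add: add_divide_distrib)
  qed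
  have set: "\<exists>h\<in>set_pmf ?P. c = ?val h" if "c \<in> set_pmf (density_estimate Q l R A B C)" for c
    using that unfolding density_estimate_def by (simp only: set_map_pmf image_iff)
  show ?thesis
    unfolding coarse_estimate_def
  proof (intro conjI ballI impI)
    show "finite (set_pmf (density_estimate Q l R A B C))"
      unfolding density_estimate_def set_map_pmf using finP by (rule finite_imageI)
    fix c assume "c \<in> set_pmf (density_estimate Q l R A B C)"
    from set[OF this] obtain h where h: "h \<in> set_pmf ?P" "c = ?val h"
      by blast
    show "0 \<le> c"
      unfolding h(2) by (rule val0)
    show "0 < c" if "0 < real ?T"
      unfolding h(2) using 2[OF _ h(1)] that by linarith
  qed (use 1 3 in \<open>simp_all add: algebra_simps\<close>)
qed

section \<open>Counting ordered triangles\<close>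

lemma implementable_density_test:
  assumes "\<And>A B C. implementable V q (\<lambda>orc. return_pmf (Q orc A B C))"
  shows "implementable V q (\<lambda>orc. density_test (Q orc) A B C x y)"
  unfolding density_test_def by (intro implementable_sample assms)

lemma implementable_density_estimate:
  assumes "\<And>A B C. implementable V q (\<lambda>orc. return_pmf (Q orc A B C))"
  shows "implementable V ((l + 1)\<^sup>2 * R * q) (\<lambda>orc. density_estimate (Q orc) l R A B C)"
proof -
  let ?J = "{..l} \<times> {..l} \<times> {..<R}"
  have "implementable V (card ?J * q)
      (\<lambda>orc. Pi_pmf ?J False (\<lambda>j. (\<lambda>(x, y, r) orc. density_test (Q orc) A B C x y) j orc))"
    using assms by (intro implementable_Pi_pmf) (auto intro!: implementable_density_test)
  from implementable_map[OF this] show ?thesis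
    unfolding density_estimate_def
    by (rule implementable_cong)
       (auto simp: case_prod_unfold card_cartesian_product power2_eq_square algebra_simps)
qed

lemma implementable_particle_step:
  assumes "finite J" "\<And>x. implementable V q (\<lambda>orc. coarse orc x)"
  shows "implementable V (N * card J * q) (\<lambda>orc. particle_step N J ch (coarse orc) s)"
proof -
  let ?I = "{..<N} \<times> J"
  have "implementable V (card ?I * q + 0) (\<lambda>orc. bind_pmf
      (Pi_pmf ?I 0 (\<lambda>j. (\<lambda>(i, j) orc. coarse orc (ch (snd (s i)) j)) j orc))
      (\<lambda>h. bind_pmf (resample N ?I (\<lambda>(i, j). fst (s i)) h) return_pmf))"
    using assms by (intro implementable_bind implementable_Pi_pmf implementable_sample)
      (auto intro: implementable.return)
  from implementable_map[OF this] show ?thesis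
    unfolding particle_step_def
    by (rule implementable_cong)
       (auto simp: case_prod_unfold card_cartesian_product bind_return_pmf')
qed

lemma implementable_particle_run:
  assumes "finite J" "\<And>k x. implementable V q (\<lambda>orc. coarse orc k x)"
    and "\<And>x. implementable V q' (\<lambda>orc. leaf orc x)"
  shows "implementable V (k * (N * card J * q) + N * q')
           (\<lambda>orc. particle_run N J ch (coarse orc) (leaf orc) k s)"
proof (induction k arbitrary: s)
  case 0
  have "implementable V (card {..<N} * q') (\<lambda>orc. Pi_pmf {..<N} 0 (\<lambda>i. leaf orc (snd (s i))))"
    using assms(3) by (intro implementable_Pi_pmf) auto
  from implementable_map[OF this] show ?case by simp
next
  case (Suc k)
  have "implementable V (N * card J * q + (k * (N * card J * q) + N * q'))
      (\<lambda>orc. bind_pmf (particle_step N J ch (coarse orc k) s)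
        (\<lambda>s'. particle_run N J ch (coarse orc) (leaf orc) k s'))"
    using assms(1,2) by (intro implementable_bind implementable_particle_step Suc.IH)
  then show ?case
    by (simp add: algebra_simps)
qed

section \<open>Simulating queries on overlapping sets\<close>

definition label_bits :: "'v set \<Rightarrow> nat \<Rightarrow> nat \<Rightarrow> 'v \<Rightarrow> bool \<times> bool" where
  "label_bits V i j v = (bit (to_nat_on V v) i, bit (to_nat_on V v) j)"

text \<open>
  Simulates a query on sets that may overlap. Among three distinct labels two of them differ in
  some bit \<open>i\<close>, and the third agrees there with one of the two, from which it differs in some
  bit \<open>j\<close>; hence the pairs of bits \<open>i, j\<close> of the three labels are pairwise distinct.
\<close>
definition simulated_query :: "'v set \<Rightarrow> nat \<Rightarrow> 'v tis \<Rightarrow> 'v tis" where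
  "simulated_query V l orc A B C \<longleftrightarrow>
     (\<exists>(i, j, p, q, r)\<in>{..<l} \<times> {..<l} \<times> UNIV \<times> UNIV \<times> UNIV.
        guarded V orc {a\<in>A. label_bits V i j a = p} {b\<in>B. label_bits V i j b = q}
          {c\<in>C. label_bits V i j c = r})"

lemma implementable_simulated_query:
  "implementable V (64 * l\<^sup>2) (\<lambda>orc. return_pmf (simulated_query V l orc A B C))"
proof -
  let ?I = "{..<l} \<times> {..<l} \<times> (UNIV :: ((bool \<times> bool) \<times> (bool \<times> bool) \<times> (bool \<times> bool)) set)"
  have "implementable V (card ?I) (\<lambda>orc. return_pmf (\<exists>x\<in>?I. guarded V orc
      {a\<in>A. label_bits V (fst x) (fst (snd x)) a = fst (snd (snd x))}
      {b\<in>B. label_bits V (fst x) (fst (snd x)) b = fst (snd (snd (snd x)))}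
      {c\<in>C. label_bits V (fst x) (fst (snd x)) c = snd (snd (snd (snd x)))}))"
    by (intro implementable_Bex_guarded) auto
  moreover have "card ?I = 64 * l\<^sup>2"
    by (simp add: card_cartesian_product power2_eq_square flip: UNIV_Times_UNIV)
  ultimately show ?thesis
    by (simp add: simulated_query_def case_prod_unfold)
qed

lemma ex_bit_neq:
  fixes a b :: nat
  assumes "a < 2 ^ l" "b < 2 ^ l" "a \<noteq> b"
  shows "\<exists>i<l. bit a i \<noteq> bit b i"
proof (rule ccontr)
  assume "\<not> ?thesis"
  then have "take_bit l a = take_bit l b"
    by (auto simp: bit_eq_iff bit_take_bit_iff)
  with assms show False
    by (simp add: take_bit_nat_eq_self)
qed

lemma to_nat_on_less_card:
  "finite V \<Longrightarrow> v \<in> V \<Longrightarrow> to_nat_on V v < card V"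
  using to_nat_on_finite[of V] by (auto simp: bij_betw_def)

text \<open>Shrinking the sets can only lose triples, so a positive answer is sound. Conversely, the
  bits that separate the vertices of a given triple cut the sets down to nonempty disjoint ones
  still containing it.\<close>

lemma simulated_query_iff:
  assumes V: "finite V" "card V \<le> 2 ^ l" and sub: "A \<subseteq> V" "B \<subseteq> V" "C \<subseteq> V"
    and distinct: "\<And>a b c. P a b c \<Longrightarrow> a \<noteq> b \<and> a \<noteq> c \<and> b \<noteq> c"
    and orc: "\<And>A B C. valid_query V A B C \<Longrightarrow> orc A B C \<longleftrightarrow> triples P A B C \<noteq> {}"
  shows "simulated_query V l orc A B C \<longleftrightarrow> triples P A B C \<noteq> {}"
proof
  assume "simulated_query V l orc A B C"
  then obtain i j p q r where *: "guarded V orc {a\<in>A. label_bits V i j a = p}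
      {b\<in>B. label_bits V i j b = q} {c\<in>C. label_bits V i j c = r}"
    by (auto simp: simulated_query_def)
  then have "triples P {a\<in>A. label_bits V i j a = p}
      {b\<in>B. label_bits V i j b = q} {c\<in>C. label_bits V i j c = r} \<noteq> {}"
    using orc by (auto simp: guarded_def)
  then show "triples P A B C \<noteq> {}"
    by (auto simp: triples_def)
next
  assume "triples P A B C \<noteq> {}"
  then obtain a b c where abc: "a \<in> A" "b \<in> B" "c \<in> C" "P a b c"
    by (auto simp: triples_def)
  let ?lab = "to_nat_on V"
  have neq: "\<exists>i<l. bit (?lab u) i \<noteq> bit (?lab v) i" if "u \<in> V" "v \<in> V" "u \<noteq> v" for u v
  proof -
    have "?lab u < 2 ^ l" "?lab v < 2 ^ l"
      using V that to_nat_on_less_card by (meson less_le_trans)+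
    moreover have "?lab u \<noteq> ?lab v"
      using that V by (simp add: countable_finite)
    ultimately show ?thesis
      by (rule ex_bit_neq)
  qed
  have abcV: "a \<in> V" "b \<in> V" "c \<in> V"
    using abc sub by auto
  obtain i where i: "i < l" "bit (?lab a) i \<noteq> bit (?lab b) i"
    using neq abcV distinct abc by meson
  obtain j where j: "j < l" "if bit (?lab c) i = bit (?lab a) i
      then bit (?lab c) j \<noteq> bit (?lab a) j else bit (?lab c) j \<noteq> bit (?lab b) j"
    using neq abcV distinct abc by (cases "bit (?lab c) i = bit (?lab a) i") metis+
  let ?X = "\<lambda>X v. {x\<in>X. label_bits V i j x = label_bits V i j v}"
  have bits: "label_bits V i j a \<noteq> label_bits V i j b" "label_bits V i j a \<noteq> label_bits V i j c"
    "label_bits V i j b \<noteq> label_bits V i j c"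
    using i j by (auto simp: label_bits_def split: if_splits)
  have "valid_query V (?X A a) (?X B b) (?X C c)"
    unfolding valid_query_def using abc sub bits by auto
  moreover have "triples P (?X A a) (?X B b) (?X C c) \<noteq> {}"
    using abc by (auto simp: triples_def)
  ultimately have "guarded V orc (?X A a) (?X B b) (?X C c)"
    using orc by (simp add: guarded_def)
  with i(1) j(1) show "simulated_query V l orc A B C"
    unfolding simulated_query_def
    by (intro bexI[of _ "(i, j, label_bits V i j a, label_bits V i j b, label_bits V i j c)"]) auto
qed

section \<open>Cells of label prefixes\<close>

definition segment :: "'v set \<Rightarrow> nat \<Rightarrow> nat \<Rightarrow> 'v set" where
  "segment V k a = {v\<in>V. to_nat_on V v div 2 ^ k = a}"

definition cell_triples :: "('v \<Rightarrow> 'v \<Rightarrow> 'v \<Rightarrow> bool) \<Rightarrow> 'v set \<Rightarrow> nat \<Rightarrow> nat \<times> nat \<times> nat \<Rightarrow> ('v \<times> 'v \<times> 'v) set" where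
  "cell_triples P V k = (\<lambda>(a, b, c). triples P (segment V k a) (segment V k b) (segment V k c))"

definition halves :: "(nat \<times> nat \<times> nat) set" where
  "halves = {0, 1} \<times> {0, 1} \<times> {0, 1}"

text \<open>Passing from \<open>a\<close> to \<open>2 * a + i\<close> appends the bit
  \<open>i\<close> to the prefix \<open>a\<close>.\<close>

definition subcell :: "nat \<times> nat \<times> nat \<Rightarrow> nat \<times> nat \<times> nat \<Rightarrow> nat \<times> nat \<times> nat" where
  "subcell = (\<lambda>(a, b, c) (i, j, k). (2 * a + i, 2 * b + j, 2 * c + k))"

lemma halves: "finite halves" "halves \<noteq> {}" "card halves = 8"
  by (auto simp: halves_def card_cartesian_product)

lemma finite_segment: "finite V \<Longrightarrow> finite (segment V k a)"
  by (simp add: segment_def)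

lemma segment_subset: "segment V k a \<subseteq> V"
  by (auto simp: segment_def)

text \<open>\<open>k\<close> counts the low-order label bits left free, so the label tree is
  descended by decreasing \<open>k\<close>.\<close>

lemma segment_Suc: "segment V (Suc k) a = (\<Union>i\<in>{0, 1}. segment V k (2 * a + i))"
proof -
  have "x div 2 ^ Suc k = a \<longleftrightarrow> x div 2 ^ k = 2 * a \<or> x div 2 ^ k = 2 * a + 1" for x :: nat
  proof -
    have "x div 2 ^ Suc k = x div 2 ^ k div 2"
      by (simp only: power_Suc2 div_mult2_eq)
    then show ?thesis by linarith
  qed
  then show ?thesis by (auto simp: segment_def)
qed

lemma segment_top:
  assumes "finite V" "card V \<le> 2 ^ l"
  shows "segment V l 0 = V"
proof -
  have "to_nat_on V v < 2 ^ l" if "v \<in> V" for v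
    using to_nat_on_less_card[OF assms(1) that] assms(2) by linarith
  then show ?thesis
    by (auto simp: segment_def)
qed

lemma segment_0_unique:
  assumes "finite V" "u \<in> segment V 0 a" "v \<in> segment V 0 a"
  shows "u = v"
  using assms by (auto simp: segment_def countable_finite)

lemma finite_cell_triples: "finite V \<Longrightarrow> finite (cell_triples P V k x)"
  by (auto simp: cell_triples_def finite_segment intro!: finite_triples split: prod.split)

lemma card_cell_triples_Suc:
  assumes "finite V"
  shows "card (cell_triples P V (Suc k) x) = (\<Sum>j\<in>halves. card (cell_triples P V k (subcell x j)))"
proof -
  obtain a b c where [simp]: "x = (a, b, c)" by (cases x)
  have "cell_triples P V (Suc k) x = (\<Union>j\<in>halves. cell_triples P V k (subcell x j))"
    by (auto simp: cell_triples_def segment_Suc halves_def subcell_def triples_def)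
  also have "card \<dots> = (\<Sum>j\<in>halves. card (cell_triples P V k (subcell x j)))"
  proof (rule card_UN_disjoint)
    show "\<forall>i\<in>halves. \<forall>j\<in>halves. i \<noteq> j \<longrightarrow>
        cell_triples P V k (subcell x i) \<inter> cell_triples P V k (subcell x j) = {}"
      by (auto simp: cell_triples_def subcell_def triples_def segment_def)
  qed (use assms in \<open>auto simp: halves(1) finite_cell_triples\<close>)
  finally show ?thesis .
qed

text \<open>With no free bit left a label determines its vertex, so a cell holds at most one
  triple.\<close>

lemma card_cell_triples_0:
  assumes "finite V"
  shows "card (cell_triples P V 0 x) = of_bool (cell_triples P V 0 x \<noteq> {})"
proof (cases "cell_triples P V 0 x = {}")
  case False
  then obtain t where t: "t \<in> cell_triples P V 0 x" by auto
  moreover have "u = v" if "u \<in> cell_triples P V 0 x" "v \<in> cell_triples P V 0 x" for u v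
    using that segment_0_unique[OF assms] by (auto simp: cell_triples_def triples_def)
  ultimately have "cell_triples P V 0 x = {t}" by blast
  then show ?thesis by simp
qed simp

text \<open>All particles start at the root cell, but only particle 0 has weight 1; the others have
  weight 0, so the initial weighted count is that of the root.\<close>

definition triple_estimator :: "'v set \<Rightarrow> nat \<Rightarrow> nat \<Rightarrow> nat \<Rightarrow> 'v tis \<Rightarrow> real pmf" where
  "triple_estimator V l R N orc =
     particle_run N halves subcell
       (\<lambda>k x. density_estimate (simulated_query V l orc) l R
          (segment V k (fst x)) (segment V k (fst (snd x))) (segment V k (snd (snd x))))
       (\<lambda>x. return_pmf (of_bool (simulated_query V l orc
          (segment V 0 (fst x)) (segment V 0 (fst (snd x))) (segment V 0 (snd (snd x))))))
       l (\<lambda>i. (of_bool (i = 0), (0, 0, 0)))"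

lemma implementable_triple_estimator:
  "implementable V (l * (N * 8 * ((l + 1)\<^sup>2 * R * (64 * l\<^sup>2))) + N * (64 * l\<^sup>2)) (triple_estimator V l R N)"
proof -
  have leaf: "implementable V (64 * l\<^sup>2) (\<lambda>orc. return_pmf (of_bool (simulated_query V l orc A B C) :: real))"
    for A B C
    using implementable_map[OF implementable_simulated_query[of V l A B C], of "of_bool :: _ \<Rightarrow> real"] by simp
  have "implementable V (l * (N * card halves * ((l + 1)\<^sup>2 * R * (64 * l\<^sup>2))) + N * (64 * l\<^sup>2)) (\<lambda>orc. triple_estimator V l R N orc)"
    unfolding triple_estimator_def
    by (intro implementable_particle_run implementable_density_estimate
        implementable_simulated_query leaf halves)
  then show ?thesis by (simp add: halves)
qed

lemma triple_estimator_moments: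
  assumes V: "finite V" "card V \<le> 2 ^ l" and l: "l > 0" and N: "N > 0"
    and distinct: "\<And>a b c. P a b c \<Longrightarrow> a \<noteq> b \<and> a \<noteq> c \<and> b \<noteq> c"
    and orc: "\<And>A B C. valid_query V A B C \<Longrightarrow> orc A B C \<longleftrightarrow> triples P A B C \<noteq> {}"
    and d: "\<And>a b. a \<in> V \<Longrightarrow> b \<in> V \<Longrightarrow> card {c\<in>V. P a b c} \<le> d"
  defines "X \<equiv> triple_estimator V l (8 * l) N orc" and "T \<equiv> real (card (triples P V V V))"
  shows "finite (set_pmf X)" "E X (\<lambda>x. x) = T"
    "E X (\<lambda>x. x\<^sup>2) \<le>
       (1 + (2 * real d * (real l + 1) + 1) * ((real l + 1)\<^sup>2 * (8 * real l)) / real N) ^ l * T\<^sup>2"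
proof -
  let ?Q = "simulated_query V l orc"
  let ?T = "\<lambda>k x. real (card (cell_triples P V k x))"
  let ?s = "\<lambda>i :: nat. (of_bool (i = 0) :: real, (0, 0, 0) :: nat \<times> nat \<times> nat)"
  let ?\<beta> = "2 * real d * (real l + 1) + 1" and ?\<gamma> = "(real l + 1)\<^sup>2 * real (8 * l)"
  have Q: "?Q A B C \<longleftrightarrow> triples P A B C \<noteq> {}" if "A \<subseteq> V" "B \<subseteq> V" "C \<subseteq> V" for A B C
    using V that distinct orc by (rule simulated_query_iff)
  have card_le: "card A \<le> 2 ^ l" if "A \<subseteq> V" for A
    using card_mono[OF V(1) that] V(2) by linarith
  have coarse: "coarse_estimate ?\<beta> ?\<gamma> (?T k x) (density_estimate ?Q l (8 * l)
      (segment V k (fst x)) (segment V k (fst (snd x))) (segment V k (snd (snd x))))" for k x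
  proof -
    obtain a b c where [simp]: "x = (a, b, c)" by (cases x)
    let ?A = "segment V k a" and ?B = "segment V k b" and ?C = "segment V k c"
    have "card (triples P ?A ?B ?C) \<le> card ?A * card ?B * card ?C"
      using V by (intro card_triples_le finite_segment)
    also have "\<dots> \<le> 2 ^ l * 2 ^ l * 2 ^ l"
      by (intro mult_mono card_le segment_subset) auto
    also have "\<dots> = 8 ^ l"
      by (simp flip: power_mult_distrib)
    finally have "real (card (triples P ?A ?B ?C)) \<le> 8 ^ l"
      using of_nat_le_iff[where 'a = real] by fastforce
    then have "card (triples P ?A ?B ?C) * (3 / 4) ^ (8 * l) \<le> (8 :: real) ^ l * (3 / 4) ^ (8 * l)"
      by (intro mult_right_mono) auto
    \<comment> \<open>\<open>8 * (3 / 4) ^ 8 < 1\<close>, which is why 8 * l repetitions suffice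
      against at most \<open>8 ^ l\<close> triples.\<close>
    also have "\<dots> = (8 * (3 / 4) ^ 8) ^ l"
      by (simp only: power_mult power_mult_distrib)
    also have "\<dots> \<le> 1"
      by (intro power_le_one) (auto simp: power_divide)
    finally have R: "card (triples P ?A ?B ?C) * (3 / 4) ^ (8 * l) \<le> (1 :: real)" .
    have "coarse_estimate ?\<beta> ?\<gamma> (card (triples P ?A ?B ?C)) (density_estimate ?Q l (8 * l) ?A ?B ?C)"
    proof (rule coarse_estimate_density_estimate)
      show "card {w\<in>?C. P u v w} \<le> d" if "u \<in> ?A" "v \<in> ?B" for u v
      proof -
        have "card {w\<in>?C. P u v w} \<le> card {w\<in>V. P u v w}"
          using V(1) by (intro card_mono) (auto simp: segment_def)
        also have "\<dots> \<le> d"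
          using that by (intro d) (auto simp: segment_def)
        finally show ?thesis .
      qed
      show "?Q A' B' ?C \<longleftrightarrow> triples P A' B' ?C \<noteq> {}" if "A' \<subseteq> ?A" "B' \<subseteq> ?B" for A' B'
        using that by (intro Q segment_subset) (meson order_trans segment_subset)+
    qed (use R V l in \<open>auto intro!: finite_segment card_le segment_subset\<close>)
    then show ?thesis
      by (simp add: cell_triples_def)
  qed
  have leaf: "return_pmf (of_bool (?Q (segment V 0 (fst x)) (segment V 0 (fst (snd x)))
      (segment V 0 (snd (snd x))))) = return_pmf (?T 0 x)" for x
    using card_cell_triples_0[OF V(1), of P x]
    by (cases x) (simp add: Q segment_subset cell_triples_def)
  have bc: "1 \<le> ?\<beta> * ?\<gamma>"
  proof -
    have "1 \<le> ?\<gamma>"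
      using l mult_mono[of 1 "(real l + 1)\<^sup>2" 1 "real (8 * l)"] by simp
    then show ?thesis
      using mult_mono[of 1 ?\<beta> 1 ?\<gamma>] by simp
  qed
  have "(\<Sum>i<N. fst (?s i) * ?T l (snd (?s i))) = ?T l (0, 0, 0)"
    using N by (simp add: of_bool_def if_distrib[of "\<lambda>x. x * _"] sum.delta cong: if_cong)
  also have "\<dots> = T"
    by (simp add: cell_triples_def T_def segment_top[OF V])
  finally have start: "(\<Sum>i<N. fst (?s i) * ?T l (snd (?s i))) = T" .
  have "finite (set_pmf X) \<and> E X (\<lambda>x. x) = (\<Sum>i<N. fst (?s i) * ?T l (snd (?s i))) \<and>
    E X (\<lambda>x. x\<^sup>2) \<le> (1 + ?\<beta> * ?\<gamma> / real N) ^ l * (\<Sum>i<N. fst (?s i) * ?T l (snd (?s i)))\<^sup>2"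
    unfolding X_def triple_estimator_def
  proof (rule particle_run_moments[where T = ?T])
    show "?T (Suc k) x = (\<Sum>j\<in>halves. ?T k (subcell x j))" for k x
      by (simp add: card_cell_triples_Suc[OF V(1)])
  qed (use halves N coarse leaf bc in auto)
  then show "finite (set_pmf X)" "E X (\<lambda>x. x) = T"
    "E X (\<lambda>x. x\<^sup>2) \<le>
       (1 + (2 * real d * (real l + 1) + 1) * ((real l + 1)\<^sup>2 * (8 * real l)) / real N) ^ l * T\<^sup>2"
    unfolding start by simp_all
qed

section \<open>Amplification\<close>

definition median :: "nat \<Rightarrow> (nat \<Rightarrow> real) \<Rightarrow> real" where
  "median m y = sort (map y [0..<m]) ! (m div 2)"

text \<open>A median below \<open>lo\<close> makes the first \<open>m div 2 + 1\<close> sorted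
  entries bad, and one above \<open>hi\<close> the last \<open>m - m div 2\<close>; either is at
  least half of all entries.\<close>

lemma median_in_interval:
  assumes "2 * card {i\<in>{..<m}. \<not> (lo \<le> y i \<and> y i \<le> hi)} < m"
  shows "lo \<le> median m y" "median m y \<le> hi"
proof -
  define xs where "xs = sort (map y [0..<m])"
  have len: "length xs = m" and sorted: "sorted xs"
    by (simp_all add: xs_def)
  have m: "m div 2 < m"
    using assms by simp
  \<comment> \<open>Sorting permutes the entries, so bad entries may be counted before or after
    it.\<close>
  have count: "2 * card {k. k < m \<and> Q (xs ! k)} < m"
    if Q: "\<And>x. Q x \<Longrightarrow> \<not> (lo \<le> x \<and> x \<le> hi)" for Q
  proof -
    have "card {k. k < m \<and> Q (xs ! k)} = size (filter_mset Q (mset xs))"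
      using len length_filter_conv_card[of Q xs] by (simp flip: mset_filter)
    also have "\<dots> = length (filter Q (map y [0..<m]))"
      unfolding xs_def mset_sort by (metis mset_filter size_mset)
    also have "\<dots> = card {k. k < m \<and> Q (y k)}"
      unfolding length_filter_conv_card by (simp cong: conj_cong)
    also have "\<dots> \<le> card {i\<in>{..<m}. \<not> (lo \<le> y i \<and> y i \<le> hi)}"
      using Q by (intro card_mono) auto
    finally show ?thesis using assms by linarith
  qed
  have "\<not> xs ! (m div 2) < lo"
  proof
    assume less: "xs ! (m div 2) < lo"
    have "{..m div 2} \<subseteq> {k. k < m \<and> xs ! k < lo}"
    proof
      fix k assume k: "k \<in> {..m div 2}"
      then have "xs ! k \<le> xs ! (m div 2)"
        using sorted m len by (intro sorted_nth_mono) auto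
      with k less m show "k \<in> {k. k < m \<and> xs ! k < lo}" by simp
    qed
    then have "card {..m div 2} \<le> card {k. k < m \<and> xs ! k < lo}"
      by (intro card_mono) auto
    moreover have "2 * card {k. k < m \<and> xs ! k < lo} < m"
      by (rule count) auto
    ultimately show False by simp
  qed
  moreover have "\<not> xs ! (m div 2) > hi"
  proof
    assume greater: "xs ! (m div 2) > hi"
    have "{m div 2..<m} \<subseteq> {k. k < m \<and> xs ! k > hi}"
    proof
      fix k assume k: "k \<in> {m div 2..<m}"
      then have "xs ! (m div 2) \<le> xs ! k"
        using sorted m len by (intro sorted_nth_mono) auto
      with k greater show "k \<in> {k. k < m \<and> xs ! k > hi}" by simp
    qed
    then have "card {m div 2..<m} \<le> card {k. k < m \<and> xs ! k > hi}"
      by (intro card_mono) auto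
    moreover have "2 * card {k. k < m \<and> xs ! k > hi} < m"
      by (rule count) auto
    ultimately show False by simp
  qed
  ultimately show "lo \<le> median m y" "median m y \<le> hi"
    by (simp_all add: median_def xs_def)
qed

text \<open>Exponential Markov inequality for \<open>16 ^ f\<close>, where \<open>f\<close> is the number of bad runs.\<close>
lemma prob_median_ge:
  assumes fin: "finite (set_pmf p)"
    and bad: "measure_pmf.prob p {x. \<not> (lo \<le> x \<and> x \<le> hi)} \<le> 1 / 16"
  shows "measure_pmf.prob (map_pmf (median m) (Pi_pmf {..<m} 0 (\<lambda>_. p))) {x. lo \<le> x \<and> x \<le> hi}
           \<ge> 1 - 1 / 2 ^ m"
proof -
  let ?B = "{x. \<not> (lo \<le> x \<and> x \<le> hi)}"
  let ?P = "Pi_pmf {..<m} 0 (\<lambda>_. p)"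
  let ?f = "\<lambda>y. card {i\<in>{..<m}. y i \<in> ?B}"
  let ?w = "\<lambda>x. if x \<in> ?B then 16 else 1 :: real"
  have finP: "finite (set_pmf ?P)"
    using fin by (intro finite_set_Pi_pmf) auto
  have prod: "(\<Prod>i<m. ?w (y i)) = 16 ^ ?f y" for y
    by (simp only: prod.If_cases finite_lessThan prod_constant power_one mult_1_right)
       (simp add: Int_def conj_commute)
  have "E p ?w = E p (\<lambda>x. 1 + 15 * indicator ?B x)"
    by (intro expectation_cong) (simp add: indicator_def)
  also have "\<dots> = 1 + 15 * measure_pmf.prob p ?B"
    using fin by (subst Bochner_Integration.integral_add) (simp_all add: integrable_measure_pmf_finite)
  also have "\<dots> \<le> 2"
    using bad by simp
  finally have Ew: "E p ?w \<le> 2" .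
  \<comment> \<open>If at least half of the runs are bad, \<open>16 ^ f \<ge> 4 ^ m\<close>, whereas
    the mean of \<open>16 ^ f\<close> is at most \<open>2 ^ m\<close>, as one run contributes a
    factor of at most \<open>1 + 15 / 16\<close>.\<close>
  have "4 ^ m * measure_pmf.prob ?P {y. m \<le> 2 * ?f y} = E ?P (\<lambda>y. 4 ^ m * indicator {y. m \<le> 2 * ?f y} y)"
    by simp
  also have "\<dots> \<le> E ?P (\<lambda>y. \<Prod>i<m. ?w (y i))"
  proof (intro expectation_mono_finite finP)
    fix y
    have "(4 :: real) ^ m \<le> 16 ^ ?f y" if "m \<le> 2 * ?f y"
    proof -
      have "(4 :: real) ^ m \<le> 4 ^ (2 * ?f y)"
        using that by (intro power_increasing) auto
      then show ?thesis by (simp add: power_mult)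
    qed
    then show "4 ^ m * indicator {y. m \<le> 2 * ?f y} y \<le> (\<Prod>i<m. ?w (y i))"
      unfolding prod by (simp add: indicator_def)
  qed
  also have "\<dots> = (\<Prod>i<m. E p ?w)"
    using fin by (intro expectation_prod_Pi_pmf integrable_measure_pmf_finite) auto
  also have "\<dots> \<le> 2 ^ m"
    using Ew by (auto intro!: power_mono Bochner_Integration.integral_nonneg_AE AE_pmfI)
  finally have "4 ^ m * measure_pmf.prob ?P {y. m \<le> 2 * ?f y} \<le> 2 ^ m" .
  then have "measure_pmf.prob ?P {y. m \<le> 2 * ?f y} \<le> 2 ^ m / 4 ^ m"
    by (simp add: field_simps)
  also have "\<dots> = 1 / 2 ^ m"
    by (simp flip: power_divide) (simp add: power_divide)
  finally have *: "measure_pmf.prob ?P {y. m \<le> 2 * ?f y} \<le> 1 / 2 ^ m" .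
  have "1 - 1 / 2 ^ m \<le> 1 - measure_pmf.prob ?P {y. m \<le> 2 * ?f y}"
    using * by simp
  also have "\<dots> = measure_pmf.prob ?P (UNIV - {y. m \<le> 2 * ?f y})"
    by (simp add: measure_pmf.prob_compl[simplified])
  also have "\<dots> \<le> measure_pmf.prob ?P (median m -` {x. lo \<le> x \<and> x \<le> hi})"
    using median_in_interval[of m lo _ hi]
    by (intro measure_pmf.finite_measure_mono) (auto simp: not_le)
  finally show ?thesis
    by (simp add: measure_map_pmf)
qed

text \<open>Chebyshev's inequality with relative error. Dividing by
  \<open>(\<epsilon> * \<bar>\<mu>\<bar>)^2\<close> is impossible for \<open>\<mu> = 0\<close>, but
  then the second moment vanishes and \<open>X\<close> is almost surely 0.\<close>

lemma prob_deviation_le: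
  fixes X :: "real pmf"
  assumes fin: "finite (set_pmf X)" and mean: "E X (\<lambda>x. x) = \<mu>"
    and second: "E X (\<lambda>x. x\<^sup>2) \<le> (1 + \<epsilon>\<^sup>2 * \<delta>) * \<mu>\<^sup>2" and \<epsilon>: "\<epsilon> > 0" and \<delta>: "\<delta> \<ge> 0"
  shows "measure_pmf.prob X {x. \<bar>x - \<mu>\<bar> > \<epsilon> * \<bar>\<mu>\<bar>} \<le> \<delta>"
proof -
  let ?B = "{x. \<bar>x - \<mu>\<bar> > \<epsilon> * \<bar>\<mu>\<bar>}"
  have int: "integrable X F" for F :: "_ \<Rightarrow> real"
    using fin by (intro integrable_measure_pmf_finite)
  have "E X (\<lambda>x. (x - \<mu>)\<^sup>2) = E X (\<lambda>x. x\<^sup>2 - 2 * \<mu> * x + \<mu>\<^sup>2)"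
    by (simp add: power2_diff algebra_simps)
  also have "\<dots> = E X (\<lambda>x. x\<^sup>2) - \<mu>\<^sup>2"
    by (simp add: Bochner_Integration.integral_add[OF int int] Bochner_Integration.integral_diff[OF int int]
        mean power2_eq_square)
  also have "\<dots> \<le> \<epsilon>\<^sup>2 * \<delta> * \<mu>\<^sup>2"
    using second by (simp add: algebra_simps)
  finally have var: "E X (\<lambda>x. (x - \<mu>)\<^sup>2) \<le> \<epsilon>\<^sup>2 * \<delta> * \<mu>\<^sup>2" .
  show ?thesis
  proof (cases "\<mu> = 0")
    case True
    have "E X (\<lambda>x. x\<^sup>2) = 0"
      using var True by (intro antisym Bochner_Integration.integral_nonneg_AE AE_pmfI) auto
    then have "AE x in X. x\<^sup>2 = 0"
      by (subst (asm) integral_nonneg_eq_0_iff_AE[OF int]) auto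
    then have "measure_pmf.prob X ?B = 0"
      using True by (subst measure_pmf_zero_iff) (auto simp: AE_measure_pmf_iff)
    with \<delta> show ?thesis by simp
  next
    case False
    have "(\<epsilon> * \<bar>\<mu>\<bar>)\<^sup>2 * measure_pmf.prob X ?B = E X (\<lambda>x. (\<epsilon> * \<bar>\<mu>\<bar>)\<^sup>2 * indicator ?B x)"
      by simp
    also have "\<dots> \<le> E X (\<lambda>x. (x - \<mu>)\<^sup>2)"
    proof (intro expectation_mono_finite fin)
      fix x
      have "(\<epsilon> * \<bar>\<mu>\<bar>)\<^sup>2 \<le> \<bar>x - \<mu>\<bar>\<^sup>2" if "x \<in> ?B"
        using that \<epsilon> by (intro power_mono) auto
      then show "(\<epsilon> * \<bar>\<mu>\<bar>)\<^sup>2 * indicator ?B x \<le> (x - \<mu>)\<^sup>2"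
        by (auto simp: indicator_def)
    qed
    also have "\<dots> \<le> (\<epsilon> * \<bar>\<mu>\<bar>)\<^sup>2 * \<delta>"
      using var by (simp add: power_mult_distrib mult_ac)
    finally show ?thesis
      using False \<epsilon> by (simp add: power_mult_distrib)
  qed
qed

text \<open>Every triangle has 6 orderings, hence the division. With \<open>2 * l\<close> runs the
  median fails with probability at most \<open>2 ^ - (2 * l)\<close>, which is at most
  \<open>1 / n^2\<close> as soon as \<open>n \<le> 2 ^ l\<close>.\<close>

definition triangle_estimator :: "'v set \<Rightarrow> nat \<Rightarrow> nat \<Rightarrow> 'v tis \<Rightarrow> real pmf" where
  "triangle_estimator V l N orc =
     map_pmf (median (2 * l)) (Pi_pmf {..<2 * l} 0
       (\<lambda>_. map_pmf (\<lambda>x. x / 6) (triple_estimator V l (8 * l) N orc)))"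

lemma implementable_triangle_estimator:
  "implementable V (2 * l * (l * (N * 8 * ((l + 1)\<^sup>2 * (8 * l) * (64 * l\<^sup>2))) + N * (64 * l\<^sup>2)))
     (triangle_estimator V l N)"
proof -
  let ?q = "l * (N * 8 * ((l + 1)\<^sup>2 * (8 * l) * (64 * l\<^sup>2))) + N * (64 * l\<^sup>2)"
  have "implementable V (card {..<2 * l} * ?q) (\<lambda>orc. triangle_estimator V l N orc)"
    unfolding triangle_estimator_def
    by (intro implementable_map implementable_Pi_pmf implementable_triple_estimator finite_lessThan)
  then show ?thesis by simp
qed

text \<open>With \<open>v = l * u\<close> in the unit interval,
  \<open>(1 + u) ^ l \<le> exp v \<le> 1 + v + v^2 \<le> 1 + 2 * v\<close>.\<close>

lemma power_one_plus_le:
  fixes u :: real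
  assumes "0 \<le> u" "real l * u \<le> 1"
  shows "(1 + u) ^ l \<le> 1 + 2 * (real l * u)"
proof -
  have "(1 + u) ^ l \<le> exp u ^ l"
    using assms by (intro power_mono) auto
  also have "\<dots> = exp (real l * u)"
    by (simp add: exp_of_nat_mult)
  also have "\<dots> \<le> 1 + real l * u + (real l * u)\<^sup>2"
    using assms by (intro exp_bound) auto
  also have "(real l * u)\<^sup>2 \<le> real l * u"
    using assms by (simp add: power2_eq_square mult_left_le)
  finally show ?thesis by (simp add: algebra_simps)
qed

text \<open>The choice of \<open>N\<close> keeps the accumulated growth of the second moment below
  \<open>1 + \<epsilon>^2 / 16\<close>, so by Chebyshev one run fails with probability at most
  \<open>1 / 16\<close>, the threshold for the median.\<close>

lemma prob_triangle_estimator: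
  assumes V: "finite V" "card V \<le> 2 ^ l" and l: "l > 0"
    and distinct: "\<And>a b c. P a b c \<Longrightarrow> a \<noteq> b \<and> a \<noteq> c \<and> b \<noteq> c"
    and orc: "\<And>A B C. valid_query V A B C \<Longrightarrow> orc A B C \<longleftrightarrow> triples P A B C \<noteq> {}"
    and d: "\<And>a b. a \<in> V \<Longrightarrow> b \<in> V \<Longrightarrow> card {c\<in>V. P a b c} \<le> d"
    and t: "card (triples P V V V) = 6 * t"
    and \<epsilon>: "0 < \<epsilon>" "\<epsilon> \<le> 1"
    and N: "real N \<ge> 32 * (real l * ((2 * real d * (real l + 1) + 1) * ((real l + 1)\<^sup>2 * (8 * real l)))) / \<epsilon>\<^sup>2"
  shows "measure_pmf.prob (triangle_estimator V l N orc) {x. \<bar>x - real t\<bar> \<le> \<epsilon> * real t} \<ge> 1 - 1 / (2 ^ l)\<^sup>2"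
proof -
  let ?X = "triple_estimator V l (8 * l) N orc"
  let ?b = "(2 * real d * (real l + 1) + 1) * ((real l + 1)\<^sup>2 * (8 * real l))"
  have b: "?b > 0"
    using l by (intro mult_pos_pos add_nonneg_pos) auto
  have "0 < 32 * (real l * ?b) / \<epsilon>\<^sup>2"
    using b l \<epsilon> by simp
  with N have N0: "N > 0"
    by (metis less_le_trans of_nat_0_less_iff)
  have X: "finite (set_pmf ?X)" "E ?X (\<lambda>x. x) = real (card (triples P V V V))"
    "E ?X (\<lambda>x. x\<^sup>2) \<le> (1 + ?b / real N) ^ l * (real (card (triples P V V V)))\<^sup>2"
    using triple_estimator_moments[OF V l N0 distinct orc d] by blast+
  have u: "real l * (?b / real N) \<le> \<epsilon>\<^sup>2 / 32"
    using N N0 \<epsilon> by (simp add: field_simps)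
  also have "\<dots> \<le> 1"
    using \<epsilon> power_le_one[of \<epsilon> 2] by simp
  finally have "(1 + ?b / real N) ^ l \<le> 1 + 2 * (real l * (?b / real N))"
    using b by (intro power_one_plus_le) auto
  also have "\<dots> \<le> 1 + \<epsilon>\<^sup>2 * (1 / 16)"
    using u by simp
  finally have "E ?X (\<lambda>x. x\<^sup>2) \<le> (1 + \<epsilon>\<^sup>2 * (1 / 16)) * (real (card (triples P V V V)))\<^sup>2"
    using X(3) by (elim order_trans) (intro mult_right_mono; simp)
  with X(1,2) \<epsilon>(1) have "measure_pmf.prob ?X {x. \<bar>x - real (6 * t)\<bar> > \<epsilon> * \<bar>real (6 * t)\<bar>} \<le> 1 / 16"
    unfolding t by (intro prob_deviation_le) auto
  also have "{x. \<bar>x - real (6 * t)\<bar> > \<epsilon> * \<bar>real (6 * t)\<bar>} =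
      (\<lambda>x. x / 6) -` {x. \<not> (real t - \<epsilon> * t \<le> x \<and> x \<le> real t + \<epsilon> * t)}"
    by auto
  finally have "measure_pmf.prob (map_pmf (\<lambda>x. x / 6) ?X)
      {x. \<not> (real t - \<epsilon> * t \<le> x \<and> x \<le> real t + \<epsilon> * t)} \<le> 1 / 16"
    by (simp add: measure_map_pmf)
  with X(1) have "measure_pmf.prob (triangle_estimator V l N orc)
      {x. real t - \<epsilon> * t \<le> x \<and> x \<le> real t + \<epsilon> * t} \<ge> 1 - 1 / 2 ^ (2 * l)"
    unfolding triangle_estimator_def by (intro prob_median_ge) auto
  also have "{x. real t - \<epsilon> * t \<le> x \<and> x \<le> real t + \<epsilon> * t} = {x. \<bar>x - real t\<bar> \<le> \<epsilon> * real t}"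
    by auto
  finally show ?thesis
    by (simp add: power_mult mult.commute)
qed

section \<open>Triangles in graphs\<close>

definition is_triangle :: "'v pair_pre_digraph \<Rightarrow> 'v \<Rightarrow> 'v \<Rightarrow> 'v \<Rightarrow> bool" where
  "is_triangle G a b c \<longleftrightarrow> (a, b) \<in> parcs G \<and> (a, c) \<in> parcs G \<and> (b, c) \<in> parcs G"

lemma finite_triangles: "finite (pverts G) \<Longrightarrow> finite (triangles G)"
  by (rule finite_subset[of _ "Pow (pverts G)"]) (auto simp: triangles_def)

context
  fixes G :: "'v pair_pre_digraph"
  assumes G: "pair_graph G"
begin

interpretation pair_graph G by (rule G)

lemma parcs_sym: "(u, v) \<in> parcs G \<Longrightarrow> (v, u) \<in> parcs G"
  using arcs_symmetric by blast

lemma parcs_neq: "(u, v) \<in> parcs G \<Longrightarrow> u \<noteq> v"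
  using no_loops by fastforce

lemma parcs_pverts: "(u, v) \<in> parcs G \<Longrightarrow> u \<in> pverts G \<and> v \<in> pverts G"
  by (simp add: in_arcsD1 in_arcsD2)

lemma is_triangle_distinct: "is_triangle G a b c \<Longrightarrow> a \<noteq> b \<and> a \<noteq> c \<and> b \<noteq> c"
  using parcs_neq by (auto simp: is_triangle_def)

lemma is_triangle_imp_triangles: "is_triangle G a b c \<Longrightarrow> {a, b, c} \<in> triangles G"
  using is_triangle_distinct[of a b c] parcs_sym parcs_pverts
  by (auto simp: triangles_def is_triangle_def)

text \<open>Disjointness of the parts makes the three vertices distinct, so a triangle with one
  vertex per part is the same as an ordered one listed by parts.\<close>

lemma tis_oracle_iff:
  assumes "valid_query (pverts G) A B C"
  shows "tis_oracle G A B C \<longleftrightarrow> triples (is_triangle G) A B C \<noteq> {}"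
proof -
  have disj: "A \<inter> B = {}" "A \<inter> C = {}" "B \<inter> C = {}"
    using assms by (auto simp: valid_query_def)
  let ?S = "{T \<in> triangles G. card (T \<inter> A) = 1 \<and> card (T \<inter> B) = 1 \<and> card (T \<inter> C) = 1}"
  have "tis_oracle G A B C \<longleftrightarrow> ?S \<noteq> {}"
    using finite_triangles[of G] finite_verts by (auto simp: tis_oracle_def tripartite_triangles_def)
  also have "\<dots> \<longleftrightarrow> triples (is_triangle G) A B C \<noteq> {}"
  proof
    assume "?S \<noteq> {}"
    then obtain T where T: "T \<in> triangles G" "card (T \<inter> A) = 1" "card (T \<inter> B) = 1" "card (T \<inter> C) = 1"
      by auto
    then obtain a b c where abc: "a \<in> T \<inter> A" "b \<in> T \<inter> B" "c \<in> T \<inter> C"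
      by (metis card_1_singletonE insertI1)
    then have "a \<noteq> b" "a \<noteq> c" "b \<noteq> c"
      using disj by auto
    with T(1) abc have "is_triangle G a b c"
      by (auto simp: triangles_def is_triangle_def)
    with abc show "triples (is_triangle G) A B C \<noteq> {}"
      by (auto simp: triples_def)
  next
    assume "triples (is_triangle G) A B C \<noteq> {}"
    then obtain a b c where abc: "a \<in> A" "b \<in> B" "c \<in> C" "is_triangle G a b c"
      by (auto simp: triples_def)
    then have "{a, b, c} \<inter> A = {a}" "{a, b, c} \<inter> B = {b}" "{a, b, c} \<inter> C = {c}"
      using disj by auto
    then have "{a, b, c} \<in> ?S"
      using is_triangle_imp_triangles[OF abc(4)] by simp
    then show "?S \<noteq> {}" by blast
  qed
  finally show ?thesis .
qed

text \<open>If \<open>(a, b)\<close> is an edge, \<open>c\<close> maps injectively to the triangle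
  \<open>{a, b, c}\<close> on it; otherwise there is no such \<open>c\<close>.\<close>

lemma card_common_neighbours_le:
  "card {c\<in>pverts G. is_triangle G a b c} \<le> max_edge_triangles G"
proof (cases "(a, b) \<in> parcs G")
  case True
  have "card {c\<in>pverts G. is_triangle G a b c} \<le> card {T \<in> triangles G. a \<in> T \<and> b \<in> T}"
  proof (rule card_inj_on_le)
    show "inj_on (\<lambda>c. {a, b, c}) {c\<in>pverts G. is_triangle G a b c}"
    proof (rule inj_onI)
      fix c c'
      assume "c \<in> {c\<in>pverts G. is_triangle G a b c}" "c' \<in> {c\<in>pverts G. is_triangle G a b c}"
        and eq: "{a, b, c} = {a, b, c'}"
      then have "c \<noteq> a" "c \<noteq> b"
        using is_triangle_distinct by blast+
      moreover have "c \<in> {a, b, c'}"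
        using eq by blast
      ultimately show "c = c'" by simp
    qed
    show "(\<lambda>c. {a, b, c}) ` {c\<in>pverts G. is_triangle G a b c} \<subseteq> {T \<in> triangles G. a \<in> T \<and> b \<in> T}"
      using is_triangle_imp_triangles by auto
    show "finite {T \<in> triangles G. a \<in> T \<and> b \<in> T}"
      using finite_triangles[OF finite_verts] by simp
  qed
  also have "\<dots> = edge_triangles G (a, b)"
    by (simp add: edge_triangles_def)
  also have "\<dots> \<le> max_edge_triangles G"
    unfolding max_edge_triangles_def using True finite_arcs by (intro Max_ge) auto
  finally show ?thesis .
qed (simp add: is_triangle_def)

text \<open>The map from ordered triples to vertex sets has fibres of size 6 over the
  triangles.\<close>

lemma card_triples_is_triangle:
  "card (triples (is_triangle G) (pverts G) (pverts G) (pverts G)) = 6 * num_triangles G"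
proof -
  let ?f = "\<lambda>T. {(a, b, c). is_triangle G a b c \<and> {a, b, c} = T}"
  have fib: "card (?f T) = 6" if T: "T \<in> triangles G" for T
  proof -
    have "card T = 3" using T by (simp add: triangles_def)
    then obtain x y z where xyz: "T = {x, y, z}" "x \<noteq> y" "x \<noteq> z" "y \<noteq> z"
      by (auto simp: card_3_iff)
    have adj: "(u, v) \<in> parcs G" if "u \<in> T" "v \<in> T" "u \<noteq> v" for u v
      using T that by (simp add: triangles_def)
    have "?f T = {(x, y, z), (x, z, y), (y, x, z), (y, z, x), (z, x, y), (z, y, x)}"
    proof (intro subset_antisym subsetI)
      fix t assume "t \<in> ?f T"
      then obtain a b c where t: "t = (a, b, c)" "is_triangle G a b c" "{a, b, c} = T"
        by auto
      then have "a \<noteq> b" "a \<noteq> c" "b \<noteq> c" "a \<in> {x, y, z}" "b \<in> {x, y, z}" "c \<in> {x, y, z}"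
        using is_triangle_distinct[OF t(2)] xyz(1) by auto
      then show "t \<in> {(x, y, z), (x, z, y), (y, x, z), (y, z, x), (z, x, y), (z, y, x)}"
        using t(1) by auto
    next
      fix t assume "t \<in> {(x, y, z), (x, z, y), (y, x, z), (y, z, x), (z, x, y), (z, y, x)}"
      then show "t \<in> ?f T"
        using xyz adj by (auto simp: is_triangle_def)
    qed
    then show ?thesis
      using xyz by simp
  qed
  have "triples (is_triangle G) (pverts G) (pverts G) (pverts G) = (\<Union>T\<in>triangles G. ?f T)"
    using is_triangle_imp_triangles parcs_pverts by (auto simp: triples_def is_triangle_def)
  also have "card \<dots> = (\<Sum>T\<in>triangles G. card (?f T))"
  proof (rule card_UN_disjoint)
    show "\<forall>T\<in>triangles G. finite (?f T)"
      \<comment> \<open>Infinite sets have \<open>card\<close> 0, so fibres of size 6 are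
        finite.\<close>
      using fib card.infinite by fastforce
  qed (auto intro: finite_triangles[OF finite_verts])
  also have "\<dots> = 6 * num_triangles G"
    using fib by (simp add: num_triangles_def)
  finally show ?thesis .
qed

text \<open>For \<open>d = 0\<close> the query bound is 0, so the answer has to be known without
  asking.\<close>

lemma num_triangles_eq_0:
  assumes "max_edge_triangles G = 0"
  shows "num_triangles G = 0"
proof -
  have "{c\<in>pverts G. is_triangle G a b c} = {}" for a b
    using card_common_neighbours_le[of a b] assms finite_verts by simp
  then have "triples (is_triangle G) (pverts G) (pverts G) (pverts G) = {}"
    by (auto simp: triples_def)
  then show ?thesis
    using card_triples_is_triangle by simp
qed

lemma finite_pverts: "finite (pverts G)"
  by (rule finite_verts)

end

section \<open>Success probability and query count on graphs\<close>

lemma prob_triangle_estimator_graph: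
  assumes G: "pair_graph G" "card (pverts G) \<le> 2 ^ l" "l > 0" "max_edge_triangles G \<le> d"
    and \<epsilon>: "0 < \<epsilon>" "\<epsilon> \<le> 1"
    and N: "real N \<ge> 32 * (real l * ((2 * real d * (real l + 1) + 1) * ((real l + 1)\<^sup>2 * (8 * real l)))) / \<epsilon>\<^sup>2"
  shows "measure_pmf.prob (triangle_estimator (pverts G) l N (tis_oracle G))
           {x. \<bar>x - real (num_triangles G)\<bar> \<le> \<epsilon> * real (num_triangles G)} \<ge> 1 - 1 / (2 ^ l)\<^sup>2"
proof (rule prob_triangle_estimator[where P = "is_triangle G"])
  show "card {c \<in> pverts G. is_triangle G a b c} \<le> d" for a b
    using card_common_neighbours_le[OF G(1)] G(4) by (rule order_trans)
  show "is_triangle G a b c \<Longrightarrow> a \<noteq> b \<and> a \<noteq> c \<and> b \<noteq> c" for a b c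
    by (rule is_triangle_distinct[OF G(1)])
  show "valid_query (pverts G) A B C \<Longrightarrow>
      tis_oracle G A B C \<longleftrightarrow> triples (is_triangle G) A B C \<noteq> {}" for A B C
    by (rule tis_oracle_iff[OF G(1)])
qed (fact finite_pverts[OF G(1)] card_triples_is_triangle[OF G(1)] assms)+

text \<open>\<open>N\<close> is \<open>O(d * l^5 / \<epsilon>^2)\<close> and each particle costs
  \<open>O(l^7)\<close> queries over all levels and runs, in total
  \<open>O(d * l^12 / \<epsilon>^2)\<close>. This is within the target by
  \<open>d \<le> d^2\<close>, \<open>l \<le> 2 * x\<close>, \<open>x \<ge> 1\<close> and
  \<open>\<epsilon> \<le> 1\<close>.\<close>

lemma query_count_le:
  fixes d l N :: nat and \<epsilon> x :: real
  assumes d: "d \<ge> 1" and l: "l \<ge> 1" "real l \<le> 2 * x" and x: "x \<ge> 6" and \<epsilon>: "0 < \<epsilon>" "\<epsilon> \<le> 1"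
    and N: "real N \<le> 32 * (real l * ((2 * real d * (real l + 1) + 1) * ((real l + 1)\<^sup>2 * (8 * real l)))) / \<epsilon>\<^sup>2 + 1"
  shows "real (2 * l * (l * (N * 8 * ((l + 1)\<^sup>2 * (8 * l) * (64 * l\<^sup>2))) + N * (64 * l\<^sup>2)))
           \<le> 2 ^ 42 * (real d ^ 2 * x ^ 18 / \<epsilon> ^ 4)"
proof -
  let ?L = "real l"
  have L: "?L \<ge> 1" and D: "real d \<ge> 1"
    using l d by simp_all
  have L1: "?L + 1 \<le> 2 * ?L"
    using L by simp
  have \<epsilon>2: "\<epsilon>\<^sup>2 \<le> 1" "\<epsilon>\<^sup>2 > 0"
    using \<epsilon> by (simp_all add: power_le_one)
  have "2 * real d * (?L + 1) + 1 \<le> 2 * real d * (2 * ?L) + real d * ?L"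
    using L1 D L mult_mono[of 1 "real d" 1 ?L] by (intro add_mono mult_left_mono) auto
  then have b: "2 * real d * (?L + 1) + 1 \<le> 5 * (real d * ?L)"
    by simp
  have L1sq: "(?L + 1)\<^sup>2 \<le> 4 * ?L\<^sup>2"
    using power_mono[OF L1, of 2] by (simp add: power_mult_distrib)
  have "32 * (?L * ((2 * real d * (?L + 1) + 1) * ((?L + 1)\<^sup>2 * (8 * ?L))))
      \<le> 32 * (?L * ((5 * (real d * ?L)) * ((4 * ?L\<^sup>2) * (8 * ?L))))"
    using b L1sq L D by (intro mult_left_mono mult_mono mult_right_mono) auto
  also have "\<dots> = 5120 * real d * ?L ^ 5"
    by (simp add: eval_nat_numeral)
  finally have "real N \<le> 5120 * real d * ?L ^ 5 / \<epsilon>\<^sup>2 + 1"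
    using N \<epsilon>2 by (meson add_right_mono divide_right_mono order_trans zero_le_power2)
  \<comment> \<open>The 1 lost in rounding \<open>N\<close> up is absorbed into the main
    term.\<close>
  also have "1 \<le> real d * ?L ^ 5 / \<epsilon>\<^sup>2"
    using D L \<epsilon>2 mult_mono[of 1 "real d" 1 "?L ^ 5"] by (simp add: le_divide_eq)
  finally have N': "real N \<le> 5121 * real d * ?L ^ 5 / \<epsilon>\<^sup>2"
    by (simp add: add_divide_distrib)
  have "real (2 * l * (l * (N * 8 * ((l + 1)\<^sup>2 * (8 * l) * (64 * l\<^sup>2))) + N * (64 * l\<^sup>2)))
      = real N * (8192 * ((?L + 1)\<^sup>2 * ?L ^ 5) + 128 * ?L ^ 3)"
  proof -
    have "2 * ?L * (?L * (N * 8 * (A * (8 * ?L) * (64 * ?L\<^sup>2))) + N * (64 * ?L\<^sup>2))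
        = real N * (8192 * (A * ?L ^ 5) + 128 * ?L ^ 3)" for A
      by (simp add: eval_nat_numeral algebra_simps)
    from this[of "(?L + 1)\<^sup>2"] show ?thesis
      by (simp add: add.commute)
  qed
  also have "\<dots> \<le> real N * (8192 * (4 * ?L\<^sup>2 * ?L ^ 5) + 128 * ?L ^ 7)"
    using L1sq L by (intro mult_left_mono add_mono mult_right_mono power_increasing) auto
  also have "\<dots> = real N * (32896 * ?L ^ 7)"
    by (simp add: eval_nat_numeral)
  also have "\<dots> \<le> (5121 * real d * ?L ^ 5 / \<epsilon>\<^sup>2) * (32896 * ?L ^ 7)"
    using N' L by (intro mult_right_mono) auto
  also have "\<dots> = 168460416 * (real d * ?L ^ 12 / \<epsilon>\<^sup>2)"
    by (simp add: eval_nat_numeral)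
  \<comment> \<open>The numerical constant is below \<open>2 ^ 30\<close>; replacing
    \<open>l\<close> by \<open>2 * x\<close> contributes \<open>2 ^ 12\<close>, hence
    \<open>2 ^ 42\<close>.\<close>
  also have "\<dots> \<le> 2 ^ 30 * (real d ^ 2 * (2 ^ 12 * x ^ 18) / \<epsilon> ^ 4)"
  proof (intro mult_mono frac_le)
    show "real d \<le> real d ^ 2"
      using D by (simp add: power2_eq_square)
    have "?L ^ 12 \<le> (2 * x) ^ 12"
      using l by (intro power_mono) auto
    also have "\<dots> = 2 ^ 12 * x ^ 12"
      by (simp add: power_mult_distrib)
    also have "\<dots> \<le> 2 ^ 12 * x ^ 18"
      using x by (intro mult_left_mono power_increasing) auto
    finally show "?L ^ 12 \<le> 2 ^ 12 * x ^ 18" .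
    show "\<epsilon> ^ 4 \<le> \<epsilon>\<^sup>2"
      using \<epsilon> by (intro power_decreasing) auto
  qed (use \<epsilon> x L in auto)
  finally show ?thesis
    by simp
qed

theorem theorem1:
  shows "\<exists>(K::real) (L::real). K > 0 \<and> L > 0 \<and>
    (\<forall>d::nat. \<exists>alg :: 'v set \<Rightarrow> real \<Rightarrow> 'v tis_alg.
      \<forall>(G :: 'v pair_pre_digraph) (\<epsilon>::real) (n::nat).
        pair_graph G \<longrightarrow> n = card (pverts G) \<longrightarrow> n \<ge> 64 \<longrightarrow>
        max_edge_triangles G \<le> d \<longrightarrow> \<epsilon> > 0 \<longrightarrow>
          legal_alg (pverts G) (alg (pverts G) \<epsilon>) \<and>
          (\<forall>(t, q) \<in> set_pmf (run_alg (tis_oracle G) (alg (pverts G) \<epsilon>)).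
             real q \<le> K * (real d ^ 2 * log 2 (real n) ^ 18 / \<epsilon> ^ 4)) \<and>
          measure_pmf.prob (run_alg (tis_oracle G) (alg (pverts G) \<epsilon>))
            {(t, q). \<bar>t - real (num_triangles G)\<bar> \<le> \<epsilon> * real (num_triangles G)}
            \<ge> 1 - L / real n ^ 2)"
proof -
  let ?bound = "\<lambda>(d :: nat) (V :: 'v set) \<epsilon> :: real.
    2 ^ 42 * (real d ^ 2 * log 2 (real (card V)) ^ 18 / \<epsilon> ^ 4)"
  let ?good = "\<lambda>(G :: 'v pair_pre_digraph) (\<epsilon> :: real).
    {x. \<bar>x - real (num_triangles G)\<bar> \<le> \<epsilon> * real (num_triangles G)}"
  \<comment> \<open>The requirements on one tree for fixed \<open>d\<close>, \<open>V\<close> and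
    \<open>\<epsilon>\<close>, quantified over the graphs on \<open>V\<close>: choice then gives an
    algorithm that cannot depend on the edges.\<close>
  define ok :: "nat \<Rightarrow> 'v set \<Rightarrow> real \<Rightarrow> 'v tis_alg \<Rightarrow> bool" where
    "ok d V \<epsilon> a \<longleftrightarrow> (\<forall>G. pair_graph G \<longrightarrow> pverts G = V \<longrightarrow> card V \<ge> 64 \<longrightarrow>
      max_edge_triangles G \<le> d \<longrightarrow> \<epsilon> > 0 \<longrightarrow>
        legal_alg V a \<and>
        (\<forall>(t, q) \<in> set_pmf (run_alg (tis_oracle G) a). real q \<le> ?bound d V \<epsilon>) \<and>
        measure_pmf.prob (map_pmf fst (run_alg (tis_oracle G) a)) (?good G \<epsilon>) \<ge> 1 - 1 / (real (card V))\<^sup>2)"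
    for d V \<epsilon> a
  have "\<exists>a. ok d V \<epsilon> a" for d V \<epsilon>
  \<comment> \<open>Here the answer 0 is correct without queries: there are no triangles, or a
    relative error of 1 is allowed.\<close>
  proof (cases "d = 0 \<or> \<epsilon> \<ge> 1")
    case True
    have "real (num_triangles G) \<le> \<epsilon> * real (num_triangles G)"
      if "pair_graph G" "max_edge_triangles G \<le> d" for G :: "'v pair_pre_digraph"
      using True num_triangles_eq_0[OF that(1)] that(2)
      by (auto intro: mult_le_cancel_right1[THEN iffD2])
    then show ?thesis
      by (intro exI[of _ "Output 0"]) (auto simp: ok_def measure_return)
  next
    case False
    show ?thesis
    proof (cases "card V \<ge> 64 \<and> \<epsilon> > 0")
      case True
      define x where "x = log 2 (real (card V))"
      \<comment> \<open>Rounding up gives \<open>n \<le> 2 ^ l\<close>, while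
        \<open>x \<ge> 6\<close> keeps \<open>l \<le> x + 1 \<le> 2 * x\<close>.\<close>
      define l where "l = nat \<lceil>x\<rceil>"
      define b where "b = 32 * (real l * ((2 * real d * (real l + 1) + 1) * ((real l + 1)\<^sup>2 * (8 * real l)))) / \<epsilon>\<^sup>2"
      define N where "N = nat \<lceil>b\<rceil>"
      have x: "x \<ge> 6"
        using True by (simp add: x_def le_log_iff)
      then have l: "real l \<ge> x" "real l \<le> x + 1"
        by (simp_all add: l_def)
      have "b \<ge> 0"
        by (simp add: b_def)
      then have N: "real N \<ge> b" "real N \<le> b + 1"
        by (simp_all add: N_def)
      have "real (card V) = 2 powr x"
        using True by (simp add: x_def)
      also have "\<dots> \<le> 2 powr real l"
        using l by simp
      finally have card: "real (card V) \<le> 2 ^ l"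
        by (simp add: powr_realpow)
      let ?q = "2 * l * (l * (N * 8 * ((l + 1)\<^sup>2 * (8 * l) * (64 * l\<^sup>2))) + N * (64 * l\<^sup>2))"
      obtain a where a: "legal_alg V a" "\<And>orc. map_pmf fst (run_alg orc a) = triangle_estimator V l N orc"
        "\<And>orc. \<forall>(t, k) \<in> set_pmf (run_alg orc a). k \<le> ?q"
        using implementable_imp_alg[OF implementable_triangle_estimator[of V l N]] by blast
      have "real ?q \<le> ?bound d V \<epsilon>"
        unfolding x_def[symmetric] using False True l x N
        by (intro query_count_le) (auto simp: b_def Suc_le_eq)
      with a(3) have q: "\<forall>(t, k) \<in> set_pmf (run_alg orc a). real k \<le> ?bound d V \<epsilon>" for orc
        by (fastforce intro: order_trans[OF of_nat_mono])
      have "measure_pmf.prob (triangle_estimator V l N (tis_oracle G)) (?good G \<epsilon>) \<ge> 1 - 1 / (real (card V))\<^sup>2"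
        if G: "pair_graph G" "pverts G = V" "max_edge_triangles G \<le> d" for G
      proof -
        have "(real (card V))\<^sup>2 \<le> (2 ^ l)\<^sup>2"
          using card by (intro power_mono) auto
        then have "1 - 1 / (real (card V))\<^sup>2 \<le> 1 - 1 / (2 ^ l)\<^sup>2"
          using True by (simp add: frac_le)
        also have "\<dots> \<le> measure_pmf.prob (triangle_estimator (pverts G) l N (tis_oracle G)) (?good G \<epsilon>)"
        proof (rule prob_triangle_estimator_graph)
          show "card (pverts G) \<le> 2 ^ l"
            using card G(2) by (metis of_nat_le_iff of_nat_numeral of_nat_power)
          show "0 < l" using l x by simp
        qed (use G False True N in \<open>auto simp: b_def\<close>)
        finally show ?thesis using G(2) by simp
      qed
      with a q show ?thesis
        by (intro exI[of _ a]) (auto simp: ok_def)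
    \<comment> \<open>For fewer than 64 vertices or nonpositive \<open>\<epsilon>\<close> the
      requirement is vacuous.\<close>
    qed (auto simp: ok_def)
  qed
  then obtain alg where alg: "\<And>d V \<epsilon>. ok d V \<epsilon> (alg d V \<epsilon>)"
    by metis
  have good: "fst -` ?good G \<epsilon> =
      {(t, q). \<bar>t - real (num_triangles G)\<bar> \<le> \<epsilon> * real (num_triangles G)}" for G and \<epsilon>
    by auto
  show ?thesis
  proof (rule exI[of _ "2 ^ 42"], rule exI[of _ 1], intro conjI allI)
    fix d :: nat
    show "\<exists>alg :: 'v set \<Rightarrow> real \<Rightarrow> 'v tis_alg.
      \<forall>(G :: 'v pair_pre_digraph) (\<epsilon>::real) (n::nat).
        pair_graph G \<longrightarrow> n = card (pverts G) \<longrightarrow> n \<ge> 64 \<longrightarrow>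
        max_edge_triangles G \<le> d \<longrightarrow> \<epsilon> > 0 \<longrightarrow>
          legal_alg (pverts G) (alg (pverts G) \<epsilon>) \<and>
          (\<forall>(t, q) \<in> set_pmf (run_alg (tis_oracle G) (alg (pverts G) \<epsilon>)).
             real q \<le> 2 ^ 42 * (real d ^ 2 * log 2 (real n) ^ 18 / \<epsilon> ^ 4)) \<and>
          measure_pmf.prob (run_alg (tis_oracle G) (alg (pverts G) \<epsilon>))
            {(t, q). \<bar>t - real (num_triangles G)\<bar> \<le> \<epsilon> * real (num_triangles G)}
            \<ge> 1 - 1 / real n ^ 2"
    proof (rule exI[of _ "alg d"], intro allI impI)
      fix G :: "'v pair_pre_digraph" and \<epsilon> :: real and n :: nat
      assume *: "pair_graph G" "n = card (pverts G)" "n \<ge> 64" "max_edge_triangles G \<le> d" "\<epsilon> > 0"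
      show "legal_alg (pverts G) (alg d (pverts G) \<epsilon>) \<and>
          (\<forall>(t, q) \<in> set_pmf (run_alg (tis_oracle G) (alg d (pverts G) \<epsilon>)).
             real q \<le> 2 ^ 42 * (real d ^ 2 * log 2 (real n) ^ 18 / \<epsilon> ^ 4)) \<and>
          measure_pmf.prob (run_alg (tis_oracle G) (alg d (pverts G) \<epsilon>))
            {(t, q). \<bar>t - real (num_triangles G)\<bar> \<le> \<epsilon> * real (num_triangles G)}
            \<ge> 1 - 1 / real n ^ 2"
        using alg[of d "pverts G" \<epsilon>, unfolded ok_def measure_map_pmf good] * by blast
    qed
  qed auto
qed

end
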